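(* Let $(X,r)$ be a finite nondegenerate square-free symmetric set which is a multipermutation solution of level $2$, and let $V=\mathbb C X$. Let $\mathcal H=\prod_{1\le i\le t}\mathcal G_i$, $H=\mathcal H^*\times\mathcal H$, and give $V$ and the symmetric algebra $\mathbb C[V]$ the $H$-grading described in the context. Let $\mathcal F:H\times H\to\mathbb C^\times$ be the 2-cocycle $$\mathcal F((\chi,g),(\chi',h))=\chi'(g),\qquad \chi,\chi'\in\mathcal H^*,\ g,h\in\mathcal H .$$ Then the cotwisted algebra $\mathbb C[V]^{\mathcal F}$ is isomorphic to $\mathbb C_R[V]$, and hence to $\mathcal A(\mathbb C,X,r)$.
   Context: A quadratic set $(X,r)$ is a nonempty set $X$ with a bijection $r:X\times X\to X\times X$, $r(x,y)=({}^xy,x^y)$; put $\mathcal L_x(y)={}^xy$, $\mathcal R_y(x)=x^y$. It is nondegenerate if all $\mathcal L_x,\mathcal R_x$ are bijective, square-free if $r(x,x)=(x,x)$ for all $x$, and a symmetric set if $r^2=\mathrm{id}$ and $r^{12}r^{23}r^{12}=r^{23}r^{12}r^{23}$ on $X^3$ (with $r^{12}=r\times\mathrm{id}$, $r^{23}=\mathrm{id}\times r$). For a nondegenerate symmetric set, $x\sim y$ iff $\mathcal L_x=\mathcal L_y$; $\mathrm{Ret}(X,r)$ is $X/\!\sim$ with the induced solution $([x],[y])\mapsto([{}^xy],[x^y])$; $(X,r)$ is a multipermutation solution of level $m$ if $m\ge0$ is minimal such that $\mathrm{Ret}^m(X,r)$ has one element. $\mathcal G\le\mathrm{Sym}(X)$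 is the group generated by all $\mathcal L_x$, and $X_1,\dots,X_t$ are the $\mathcal G$-orbits. For level $2$ (finite, square-free) it is known that $\mathcal G$ is abelian and $\mathcal L_x=\mathcal L_y$ for $x,y$ in the same orbit; $\sigma^i_j\in\mathrm{Sym}(X_j)$ denotes the common restriction $\mathcal L_x|_{X_j}$ for $x\in X_i$. $\mathcal G_i\le\mathrm{Sym}(X_i)$ is the (abelian) group generated by all $\mathcal L_x|_{X_i}$, $x\in X$. $\mathcal H^*$ is the group of characters $\mathcal H\to\mathbb C^\times$. $R:V\otimes V\to V\otimes V$ is the linear extension $R(x\otimes y)={}^xy\otimes x^y$. $\mathbb C_R[V]$ is the tensor algebra $TV$ modulo the two-sided ideal generated by the image of $\mathrm{id}-R$. $\mathcal A(\mathbb C,X,r)$ is the free associative algebra $\mathbb C\langle X\rangle$ modulo the relations $xy=zt$ whenever $r(x,y)=(z,t)$. $H$-grading: let $V_i=\mathbb C X_i$ and $\gamma^i=\prod_{1\le j\le t}\sigma^i_j\in\mathcal H$. Let $\mathcal H$ act on $V$ by letting the factor $\mathcal G_i$ act on $V_i$ by its permutation action and trivially on $V_j$, $j\ne i$. An element $v\in V_i$ is homogeneous of degree $(\chi,\gamma^i)\in\mathcal H^*\times\mathcal H$ if $h.v=\chi(h)v$ for all $h\in\mathcal H$. This makes $V$ an $H$-graded vector space, and the grading extends multiplicatively to the symmetric algebra $\mathbb C[V]$ (commutative polynomials in a basis of $V$), since $H$ is abelian. Cotwist: for a group $H$, an $H$-graded algebra $\mathcal A$ and a 2-cocycle $\mathcal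 F:H\times H\to k^\times$ (i.e. $\mathcal F(a,bc)\mathcal F(b,c)=\mathcal F(a,b)\mathcal F(ab,c)$, $\mathcal F(e,a)=1$), $\mathcal A^{\mathcal F}$ is the same vector space with the associative product $f\bullet g=\mathcal F(|f|,|g|)\,fg$ on homogeneous $f,g$ of degrees $|f|,|g|$. *)

theory Defs
  imports
    Complex_Main
    "HOL-Library.FuncSet"
    "HOL-Library.Poly_Mapping"
    "HOL-Algebra.Bij"
    "HOL-Algebra.Group_Action"
    "HOL-Algebra.Product_Groups"
    "HOL-Algebra.Elementary_Groups"
    "HOL-Algebra.QuotRing"
    "HOL-Algebra.Module"
begin

section \<open>Quadratic sets and symmetric sets\<close>

text \<open>A set-theoretic map \<open>r\<close> on a carrier \<open>X\<close>; only its values on \<open>X \<times> X\<close> matter.\<close>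

definition quadratic_set :: "'a set \<Rightarrow> ('a \<times> 'a \<Rightarrow> 'a \<times> 'a) \<Rightarrow> bool" where
  "quadratic_set X r \<longleftrightarrow> X \<noteq> {} \<and> bij_betw r (X \<times> X) (X \<times> X)"

definition lact :: "('a \<times> 'a \<Rightarrow> 'a \<times> 'a) \<Rightarrow> 'a \<Rightarrow> 'a \<Rightarrow> 'a" where
  "lact r x y = fst (r (x, y))"

definition ract :: "('a \<times> 'a \<Rightarrow> 'a \<times> 'a) \<Rightarrow> 'a \<Rightarrow> 'a \<Rightarrow> 'a" where
  "ract r y x = snd (r (x, y))"

definition nondegenerate :: "'a set \<Rightarrow> ('a \<times> 'a \<Rightarrow> 'a \<times> 'a) \<Rightarrow> bool" where
  "nondegenerate X r \<longleftrightarrow> (\<forall>x\<in>X. bij_betw (lact r x) X X \<and> bij_betw (ract r x) X X)"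

definition square_free :: "'a set \<Rightarrow> ('a \<times> 'a \<Rightarrow> 'a \<times> 'a) \<Rightarrow> bool" where
  "square_free X r \<longleftrightarrow> (\<forall>x\<in>X. r (x, x) = (x, x))"

definition r12 :: "('a \<times> 'a \<Rightarrow> 'a \<times> 'a) \<Rightarrow> 'a \<times> 'a \<times> 'a \<Rightarrow> 'a \<times> 'a \<times> 'a" where
  "r12 r = (\<lambda>(x, y, z). (fst (r (x, y)), snd (r (x, y)), z))"

definition r23 :: "('a \<times> 'a \<Rightarrow> 'a \<times> 'a) \<Rightarrow> 'a \<times> 'a \<times> 'a \<Rightarrow> 'a \<times> 'a \<times> 'a" where
  "r23 r = (\<lambda>(x, y, z). (x, r (y, z)))"

definition symmetric_set :: "'a set \<Rightarrow> ('a \<times> 'a \<Rightarrow> 'a \<times> 'a) \<Rightarrow> bool" where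
  "symmetric_set X r \<longleftrightarrow>
     quadratic_set X r \<and>
     (\<forall>p\<in>X \<times> X. r (r p) = p) \<and>
     (\<forall>p\<in>X \<times> X \<times> X. r12 r (r23 r (r12 r p)) = r23 r (r12 r (r23 r p)))"


section \<open>Retractions and multipermutation level\<close>

definition ret_rel :: "'a set \<Rightarrow> ('a \<times> 'a \<Rightarrow> 'a \<times> 'a) \<Rightarrow> ('a \<times> 'a) set" where
  "ret_rel X r = {(x, y). x \<in> X \<and> y \<in> X \<and> (\<forall>z\<in>X. lact r x z = lact r y z)}"

definition ret_set :: "'a set \<Rightarrow> ('a \<times> 'a \<Rightarrow> 'a \<times> 'a) \<Rightarrow> 'a set set" where
  "ret_set X r = X // ret_rel X r"

text \<open>The induced solution on classes. For a nondegenerate symmetric set the result does not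
  depend on the representatives, so that each union below is a union of equal classes.\<close>

definition ret_map ::
    "'a set \<Rightarrow> ('a \<times> 'a \<Rightarrow> 'a \<times> 'a) \<Rightarrow> 'a set \<times> 'a set \<Rightarrow> 'a set \<times> 'a set" where
  "ret_map X r = (\<lambda>(A, B).
     (\<Union>x\<in>A. \<Union>y\<in>B. ret_rel X r `` {fst (r (x, y))},
      \<Union>x\<in>A. \<Union>y\<in>B. ret_rel X r `` {snd (r (x, y))}))"

text \<open>Level 2: the smallest \<open>m\<close> for which the \<open>m\<close>-fold retract has one element is 2. As each
  retraction changes the type of the carrier, the levels 0, 1, 2 are written out.\<close>

definition mpl_level_2 :: "'a set \<Rightarrow> ('a \<times> 'a \<Rightarrow> 'a \<times> 'a) \<Rightarrow> bool" where
  "mpl_level_2 X r \<longleftrightarrow>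
     \<not> is_singleton X \<and>
     \<not> is_singleton (ret_set X r) \<and>
     is_singleton (ret_set (ret_set X r) (ret_map X r))"


section \<open>Permutation groups attached to a solution\<close>

definition perm_group :: "'a set \<Rightarrow> ('a \<times> 'a \<Rightarrow> 'a \<times> 'a) \<Rightarrow> ('a \<Rightarrow> 'a) monoid" where
  "perm_group X r = subgroup_generated (BijGroup X) ((\<lambda>x. restrict (lact r x) X) ` X)"

text \<open>The orbits themselves serve as the indices \<open>i\<close> of the orbits \<open>X\<^sub>i\<close>.\<close>

definition orbs :: "'a set \<Rightarrow> ('a \<times> 'a \<Rightarrow> 'a \<times> 'a) \<Rightarrow> 'a set set" where
  "orbs X r = orbits (perm_group X r) X (\<lambda>g. g)"

definition orb_of :: "'a set \<Rightarrow> ('a \<times> 'a \<Rightarrow> 'a \<times> 'a) \<Rightarrow> 'a \<Rightarrow> 'a set" where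
  "orb_of X r x = orbit (perm_group X r) (\<lambda>g. g) x"

definition orb_group :: "'a set \<Rightarrow> ('a \<times> 'a \<Rightarrow> 'a \<times> 'a) \<Rightarrow> 'a set \<Rightarrow> ('a \<Rightarrow> 'a) monoid" where
  "orb_group X r i = subgroup_generated (BijGroup i) ((\<lambda>x. restrict (lact r x) i) ` X)"

definition sigma :: "('a \<times> 'a \<Rightarrow> 'a \<times> 'a) \<Rightarrow> 'a set \<Rightarrow> 'a set \<Rightarrow> 'a \<Rightarrow> 'a" where
  "sigma r i j = (THE s. \<forall>x\<in>i. s = restrict (lact r x) j)"

definition calH :: "'a set \<Rightarrow> ('a \<times> 'a \<Rightarrow> 'a \<times> 'a) \<Rightarrow> ('a set \<Rightarrow> 'a \<Rightarrow> 'a) monoid" where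
  "calH X r = product_group (orbs X r) (orb_group X r)"

definition gam :: "'a set \<Rightarrow> ('a \<times> 'a \<Rightarrow> 'a \<times> 'a) \<Rightarrow> 'a set \<Rightarrow> 'a set \<Rightarrow> 'a \<Rightarrow> 'a" where
  "gam X r i = (\<lambda>j\<in>orbs X r. sigma r i j)"

definition complex_units :: "complex monoid" where
  "complex_units = \<lparr>carrier = - {0}, mult = (*), one = 1\<rparr>"

definition char_group :: "('g, 'b) monoid_scheme \<Rightarrow> ('g \<Rightarrow> complex) monoid" where
  "char_group G =
     \<lparr>carrier = hom G complex_units \<inter> extensional (carrier G),
      mult = (\<lambda>\<chi> \<psi>. \<lambda>g\<in>carrier G. \<chi> g * \<psi> g),
      one = (\<lambda>g\<in>carrier G. 1)\<rparr>"

type_synonym 'a calH_elt = "'a set \<Rightarrow> 'a \<Rightarrow> 'a"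
type_synonym 'a degree = "('a calH_elt \<Rightarrow> complex) \<times> 'a calH_elt"

definition degree_group :: "'a set \<Rightarrow> ('a \<times> 'a \<Rightarrow> 'a \<times> 'a) \<Rightarrow> 'a degree monoid" where
  "degree_group X r = char_group (calH X r) \<times>\<times> calH X r"


section \<open>Complex algebras\<close>

text \<open>A complex algebra is a record of type \<^typ>\<open>(complex, 'v) module\<close>, which has the fields of
  a ring together with a scalar multiplication. The free vector space on a set is modelled by
  finitely supported functions.\<close>

definition cscale :: "complex \<Rightarrow> ('b \<Rightarrow>\<^sub>0 complex) \<Rightarrow> 'b \<Rightarrow>\<^sub>0 complex" where
  "cscale c = Poly_Mapping.map ((*) c)"

definition lin_ext :: "('b \<Rightarrow> ('c \<Rightarrow>\<^sub>0 complex)) \<Rightarrow> ('b \<Rightarrow>\<^sub>0 complex) \<Rightarrow> 'c \<Rightarrow>\<^sub>0 complex" where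
  "lin_ext f v = (\<Sum>k\<in>Poly_Mapping.keys v. cscale (Poly_Mapping.lookup v k) (f k))"

definition quot_alg :: "(complex, 'v) module \<Rightarrow> 'v set \<Rightarrow> (complex, 'v set) module" where
  "quot_alg A I =
     \<lparr>carrier = carrier (A Quot I),
      mult = mult (A Quot I),
      one = one (A Quot I),
      zero = zero (A Quot I),
      add = add (A Quot I),
      smult = (\<lambda>c S. \<Union>f\<in>S. I +>\<^bsub>A\<^esub> (c \<odot>\<^bsub>A\<^esub> f))\<rparr>"

definition alg_iso :: "(complex, 'v) module \<Rightarrow> (complex, 'w) module \<Rightarrow> ('v \<Rightarrow> 'w) set" where
  "alg_iso A B =
     {\<phi> \<in> ring_iso A B. \<forall>c. \<forall>f\<in>carrier A. \<phi> (c \<odot>\<^bsub>A\<^esub> f) = c \<odot>\<^bsub>B\<^esub> \<phi> f}"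

definition alg_isomorphic :: "(complex, 'v) module \<Rightarrow> (complex, 'w) module \<Rightarrow> bool" where
  "alg_isomorphic A B \<longleftrightarrow> alg_iso A B \<noteq> {}"


section \<open>Cotwists of graded algebras\<close>

text \<open>A grading of \<open>A\<close> by a group \<open>H\<close> is given by its homogeneous components
  \<open>Gr d\<close>, \<open>d \<in> H\<close>. The family of homogeneous parts of an element:\<close>

definition hom_parts ::
    "(complex, 'v) module \<Rightarrow> 'h monoid \<Rightarrow> ('h \<Rightarrow> 'v set) \<Rightarrow> 'v \<Rightarrow> 'h \<Rightarrow> 'v" where
  "hom_parts A H Gr f =
     (THE c. c \<in> (\<Pi>\<^sub>E d\<in>carrier H. Gr d) \<and>
             finite {d \<in> carrier H. c d \<noteq> \<zero>\<^bsub>A\<^esub>} \<and>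
             f = (\<Oplus>\<^bsub>A\<^esub>d\<in>{d \<in> carrier H. c d \<noteq> \<zero>\<^bsub>A\<^esub>}. c d))"

definition hom_supp ::
    "(complex, 'v) module \<Rightarrow> 'h monoid \<Rightarrow> ('h \<Rightarrow> 'v set) \<Rightarrow> 'v \<Rightarrow> 'h set" where
  "hom_supp A H Gr f = {d \<in> carrier H. hom_parts A H Gr f d \<noteq> \<zero>\<^bsub>A\<^esub>}"

text \<open>The bilinear product that is \<open>F a b\<close> times the old one on homogeneous elements of
  degrees \<open>a\<close> and \<open>b\<close>:\<close>

definition cotwist ::
    "(complex, 'v) module \<Rightarrow> 'h monoid \<Rightarrow> ('h \<Rightarrow> 'v set) \<Rightarrow> ('h \<Rightarrow> 'h \<Rightarrow> complex)
       \<Rightarrow> (complex, 'v) module" where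
  "cotwist A H Gr F = A\<lparr>mult := (\<lambda>f g.
     \<Oplus>\<^bsub>A\<^esub>a\<in>hom_supp A H Gr f. \<Oplus>\<^bsub>A\<^esub>b\<in>hom_supp A H Gr g.
       F a b \<odot>\<^bsub>A\<^esub> (hom_parts A H Gr f a \<otimes>\<^bsub>A\<^esub> hom_parts A H Gr g b))\<rparr>"

definition two_cocycle :: "'h monoid \<Rightarrow> ('h \<Rightarrow> 'h \<Rightarrow> complex) \<Rightarrow> bool" where
  "two_cocycle H F \<longleftrightarrow>
     (\<forall>a\<in>carrier H. \<forall>b\<in>carrier H. F a b \<noteq> 0) \<and>
     (\<forall>a\<in>carrier H. \<forall>b\<in>carrier H. \<forall>c\<in>carrier H.
        F a (b \<otimes>\<^bsub>H\<^esub> c) * F b c = F a b * F (a \<otimes>\<^bsub>H\<^esub> b) c) \<and>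
     (\<forall>a\<in>carrier H. F \<one>\<^bsub>H\<^esub> a = 1)"

definition eval_cocycle :: "('g \<Rightarrow> complex) \<times> 'g \<Rightarrow> ('g \<Rightarrow> complex) \<times> 'g \<Rightarrow> complex" where
  "eval_cocycle = (\<lambda>(\<chi>, g) (\<chi>', h). \<chi>' g)"

lemma two_cocycle_eval_cocycle:
  assumes "group G"
  shows "two_cocycle (char_group G \<times>\<times> G) eval_cocycle"
proof -
  interpret group G by fact
  have one: "\<chi> \<one>\<^bsub>G\<^esub> = 1" if "\<chi> \<in> hom G complex_units" for \<chi>
  proof -
    have "\<chi> \<one>\<^bsub>G\<^esub> = \<chi> \<one>\<^bsub>G\<^esub> * \<chi> \<one>\<^bsub>G\<^esub>"
      using hom_mult[OF that, of "\<one>\<^bsub>G\<^esub>" "\<one>\<^bsub>G\<^esub>"] by (simp add: complex_units_def)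
    moreover have "\<chi> \<one>\<^bsub>G\<^esub> \<noteq> 0"
      using hom_in_carrier[OF that, of "\<one>\<^bsub>G\<^esub>"] by (simp add: complex_units_def)
    ultimately show ?thesis by simp
  qed
  show ?thesis
    unfolding two_cocycle_def eval_cocycle_def
    using one by (auto simp: char_group_def hom_def complex_units_def Pi_iff)
qed


section \<open>The algebras attached to a solution\<close>

text \<open>The symmetric algebra of \<open>V = \<complex>X\<close>: commutative polynomials with variables in \<open>X\<close>.\<close>

type_synonym 'a cpoly = "('a \<Rightarrow>\<^sub>0 nat) \<Rightarrow>\<^sub>0 complex"

definition sym_alg :: "'a set \<Rightarrow> (complex, 'a cpoly) module" where
  "sym_alg X =
     \<lparr>carrier = {p. \<forall>m\<in>Poly_Mapping.keys p. Poly_Mapping.keys m \<subseteq> X},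
      mult = (*), one = 1, zero = 0, add = (+), smult = cscale\<rparr>"

definition sym_incl :: "('a \<Rightarrow>\<^sub>0 complex) \<Rightarrow> 'a cpoly" where
  "sym_incl = lin_ext (\<lambda>x. Poly_Mapping.single (Poly_Mapping.single x 1) 1)"

definition calH_act ::
    "'a set \<Rightarrow> ('a \<times> 'a \<Rightarrow> 'a \<times> 'a) \<Rightarrow> 'a calH_elt \<Rightarrow> ('a \<Rightarrow>\<^sub>0 complex) \<Rightarrow> 'a \<Rightarrow>\<^sub>0 complex" where
  "calH_act X r h = lin_ext (\<lambda>x. Poly_Mapping.single (h (orb_of X r x) x) 1)"

text \<open>\<open>v \<in> V\<^sub>i\<close>, for some orbit \<open>i\<close>, is homogeneous of degree \<open>d\<close>. Different orbits may have the
  same \<open>\<gamma>\<close>, so vectors from several \<open>V\<^sub>i\<close> can share a degree.\<close>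

definition vec_homog ::
    "'a set \<Rightarrow> ('a \<times> 'a \<Rightarrow> 'a \<times> 'a) \<Rightarrow> ('a \<Rightarrow>\<^sub>0 complex) \<Rightarrow> 'a degree \<Rightarrow> bool" where
  "vec_homog X r v d \<longleftrightarrow>
     (\<exists>i\<in>orbs X r. \<exists>\<chi>\<in>carrier (char_group (calH X r)).
        d = (\<chi>, gam X r i) \<and>
        Poly_Mapping.keys v \<subseteq> i \<and>
        (\<forall>h\<in>carrier (calH X r). calH_act X r h v = cscale (\<chi> h) v))"

text \<open>Products of homogeneous vectors, with the product of their degrees; these span the
  homogeneous components of the symmetric algebra.\<close>

inductive prod_homog ::
    "'a set \<Rightarrow> ('a \<times> 'a \<Rightarrow> 'a \<times> 'a) \<Rightarrow> 'a cpoly \<Rightarrow> 'a degree \<Rightarrow> bool"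
  for X :: "'a set" and r :: "'a \<times> 'a \<Rightarrow> 'a \<times> 'a" where
  one: "prod_homog X r 1 \<one>\<^bsub>degree_group X r\<^esub>"
| mult: "vec_homog X r v d \<Longrightarrow> prod_homog X r f e \<Longrightarrow>
    prod_homog X r (sym_incl v * f) (d \<otimes>\<^bsub>degree_group X r\<^esub> e)"

definition sym_grading ::
    "'a set \<Rightarrow> ('a \<times> 'a \<Rightarrow> 'a \<times> 'a) \<Rightarrow> 'a degree \<Rightarrow> 'a cpoly set" where
  "sym_grading X r d = Modules.module.span cscale {f. prod_homog X r f d}"

definition cotwisted_sym_alg ::
    "'a set \<Rightarrow> ('a \<times> 'a \<Rightarrow> 'a \<times> 'a) \<Rightarrow> (complex, 'a cpoly) module" where
  "cotwisted_sym_alg X r =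
     cotwist (sym_alg X) (degree_group X r) (sym_grading X r) eval_cocycle"

text \<open>The free associative algebra on \<open>X\<close>, which is also the tensor algebra of \<open>V = \<complex>X\<close>: the word
  \<open>[x\<^sub>1, \<dots>, x\<^sub>n]\<close> stands for \<open>x\<^sub>1 \<otimes> \<dots> \<otimes> x\<^sub>n\<close>, and the words of length \<open>n\<close> are a basis of
  the \<open>n\<close>-th tensor power of \<open>V\<close>.\<close>

definition word_mult ::
    "('a list \<Rightarrow>\<^sub>0 complex) \<Rightarrow> ('a list \<Rightarrow>\<^sub>0 complex) \<Rightarrow> 'a list \<Rightarrow>\<^sub>0 complex" where
  "word_mult f g =
     (\<Sum>u\<in>Poly_Mapping.keys f. \<Sum>v\<in>Poly_Mapping.keys g.
        Poly_Mapping.single (u @ v) (Poly_Mapping.lookup f u * Poly_Mapping.lookup g v))"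

definition free_alg :: "'a set \<Rightarrow> (complex, 'a list \<Rightarrow>\<^sub>0 complex) module" where
  "free_alg X =
     \<lparr>carrier = {f. Poly_Mapping.keys f \<subseteq> lists X},
      mult = word_mult, one = Poly_Mapping.single [] 1, zero = 0, add = (+), smult = cscale\<rparr>"

abbreviation tensor_alg :: "'a set \<Rightarrow> (complex, 'a list \<Rightarrow>\<^sub>0 complex) module" where
  "tensor_alg \<equiv> free_alg"

definition tensor_square :: "'a set \<Rightarrow> ('a list \<Rightarrow>\<^sub>0 complex) set" where
  "tensor_square X = {f \<in> carrier (tensor_alg X). \<forall>w\<in>Poly_Mapping.keys f. length w = 2}"

text \<open>The linear extension of \<open>r\<close> to the tensor square (used on \<^const>\<open>tensor_square\<close> only):\<close>

definition lin_R ::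
    "('a \<times> 'a \<Rightarrow> 'a \<times> 'a) \<Rightarrow> ('a list \<Rightarrow>\<^sub>0 complex) \<Rightarrow> 'a list \<Rightarrow>\<^sub>0 complex" where
  "lin_R r = lin_ext (\<lambda>w. Poly_Mapping.single
     [fst (r (w ! 0, w ! 1)), snd (r (w ! 0, w ! 1))] 1)"

definition R_sym_alg ::
    "'a set \<Rightarrow> ('a \<times> 'a \<Rightarrow> 'a \<times> 'a) \<Rightarrow> (complex, ('a list \<Rightarrow>\<^sub>0 complex) set) module" where
  "R_sym_alg X r =
     quot_alg (tensor_alg X)
       (genideal (tensor_alg X) ((\<lambda>f. f - lin_R r f) ` tensor_square X))"

definition YB_alg ::
    "'a set \<Rightarrow> ('a \<times> 'a \<Rightarrow> 'a \<times> 'a) \<Rightarrow> (complex, ('a list \<Rightarrow>\<^sub>0 complex) set) module" where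
  "YB_alg X r =
     quot_alg (free_alg X)
       (genideal (free_alg X)
         {Poly_Mapping.single [x, y] 1 - Poly_Mapping.single [z, t] 1 | x y z t.
            x \<in> X \<and> y \<in> X \<and> z \<in> X \<and> t \<in> X \<and> r (x, y) = (z, t)})"

end

theory Submission
  imports Defs "HOL-Algebra.Multiplicative_Group"
begin

text \<open>
  Everything rests on two consequences of level two: \<open>L\<^sub>x\<close> depends only on the orbit of
  \<open>x\<close>, and the permutations \<open>L\<^sub>x\<close> commute. Moreover \<open>x\<^sup>y\<close> is
  the preimage of \<open>x\<close> under \<open>L\<^sub>y\<close>. The first two facts follow from the braid
  relation once the last one is known, and the last one holds because square-freeness forces the cyclic
  condition \<open>cyclic_condition\<close>.

  Compute the cotwisted product of two variables. The cocycle takes the character of the second factor at the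
  group element of the first one; on an eigenvector this scalar is exactly what the action of that group element
  produces. Hence, for homogeneous \<open>f\<close>, \<open>f \<bullet> g\<close> is the ordinary product of
  \<open>f\<close> with the translate of \<open>g\<close> by the group part of the degree of \<open>f\<close>.
  All monomials are homogeneous for the group part of the degree, so this description is linear in
  \<open>f\<close> and no longer mentions characters: \<open>m \<bullet> g = m \<cdot> (\<gamma>\<^sub>m .
  g)\<close> for a monomial \<open>m\<close>, and in particular \<open>x \<bullet> y = x \<cdot> L\<^sub>x
  y\<close>. This is \<open>mult_cotwisted\<close>. It presupposes that the homogeneous components really form a
  direct sum decomposition: they span because commuting operators of finite order have a basis of joint
  eigenvectors (\<open>joint_eigen_decomposition\<close>), and they are independent because eigenvectors with
  different eigenvalues are (\<open>separated_eigenvectors_independent\<close>).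

  Consequently the map from the free algebra to the cotwisted algebra that fixes the variables sends the word
  \<open>x\<^sub>1 x\<^sub>2 x\<^sub>3 \<dots>\<close> to the monomial \<open>x\<^sub>1 \<cdot>
  L\<^sub>x\<^sub>1 x\<^sub>2 \<cdot> L\<^sub>x\<^sub>1 L\<^sub>x\<^sub>2 x\<^sub>3 \<cdots>\<close>. It kills
  the defining relations, for \<open>x \<cdot> L\<^sub>x y\<close> takes the same value on \<open>(x, y)\<close>
  and on \<open>r (x, y)\<close>. It is onto, since the letters of a word can be chosen one after the other to
  produce any given monomial. Its kernel is no larger than the ideal of the relations, because two words with
  the same monomial differ by relations: any factor of the monomial can be moved to the front of the word
  (\<open>letter_to_front\<close>), and one inducts on the length. Finally, the ideal generated by the image of
  \<open>id - R\<close> is the same ideal, as \<open>R\<close> is the linear extension of \<open>r\<close>.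
\<close>

section \<open>Square-free solutions of multipermutation level two\<close>

locale level2_solution =
  fixes X :: "'a set" and r :: "'a \<times> 'a \<Rightarrow> 'a \<times> 'a"
  assumes finite_X: "finite X"
    and symmetric: "symmetric_set X r"
    and nondegenerate: "nondegenerate X r"
    and square_free: "square_free X r"
    and level_2: "mpl_level_2 X r"
begin

abbreviation L :: "'a \<Rightarrow> 'a \<Rightarrow> 'a" where "L \<equiv> lact r"

abbreviation R :: "'a \<Rightarrow> 'a \<Rightarrow> 'a" where "R \<equiv> ract r"

lemma r_eq: "r (x, y) = (L x y, R y x)"
  by (simp add: lact_def ract_def)

lemma L_bij: "x \<in> X \<Longrightarrow> bij_betw (L x) X X"
  and R_bij: "x \<in> X \<Longrightarrow> bij_betw (R x) X X"
  using nondegenerate by (auto simp: nondegenerate_def)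

lemma L_in [simp, intro]: "x \<in> X \<Longrightarrow> y \<in> X \<Longrightarrow> L x y \<in> X"
  and R_in [simp, intro]: "x \<in> X \<Longrightarrow> y \<in> X \<Longrightarrow> R x y \<in> X"
  using L_bij R_bij bij_betwE by fast+

lemma L_eq_iff [simp]: "x \<in> X \<Longrightarrow> y \<in> X \<Longrightarrow> z \<in> X \<Longrightarrow> L x y = L x z \<longleftrightarrow> y = z"
  by (metis L_bij bij_betw_imp_inj_on inj_on_eq_iff)

lemma R_eq_iff: "x \<in> X \<Longrightarrow> y \<in> X \<Longrightarrow> z \<in> X \<Longrightarrow> R x y = R x z \<longleftrightarrow> y = z"
  by (metis R_bij bij_betw_imp_inj_on inj_on_eq_iff)

lemma L_self [simp]: "x \<in> X \<Longrightarrow> L x x = x"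
  and R_self [simp]: "x \<in> X \<Longrightarrow> R x x = x"
  using square_free by (auto simp: square_free_def lact_def ract_def)

lemma L_involutive: "x \<in> X \<Longrightarrow> y \<in> X \<Longrightarrow> L (L x y) (R y x) = x"
  and R_involutive: "x \<in> X \<Longrightarrow> y \<in> X \<Longrightarrow> R (R y x) (L x y) = y"
proof -
  assume "x \<in> X" "y \<in> X"
  then have "r (r (x, y)) = (x, y)"
    using symmetric by (simp add: symmetric_set_def)
  then show "L (L x y) (R y x) = x" "R (R y x) (L x y) = y"
    by (simp_all add: r_eq)
qed

lemma braid:
  assumes "x \<in> X" "y \<in> X" "z \<in> X"
  shows braid_fst: "L x (L y z) = L (L x y) (L (R y x) z)"
    and braid_snd: "R (L (R y x) z) (L x y) = L (R (L y z) x) (R z y)"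
proof -
  have "(x, y, z) \<in> X \<times> X \<times> X"
    using assms by auto
  then have "r12 r (r23 r (r12 r (x, y, z))) = r23 r (r12 r (r23 r (x, y, z)))"
    using symmetric unfolding symmetric_set_def by blast
  then show "L x (L y z) = L (L x y) (L (R y x) z)"
    "R (L (R y x) z) (L x y) = L (R (L y z) x) (R z y)"
    by (simp_all add: r12_def r23_def r_eq)
qed

text \<open>Put \<open>z = y\<close> in the second component of the braid relation. By square-freeness it says that
  the bijection \<open>R v\<close>, with \<open>v = L (R y x) y\<close>, sends \<open>L x y\<close> to \<open>v\<close>, which it also fixes.\<close>
lemma cyclic_condition:
  assumes "x \<in> X" "y \<in> X"
  shows "L (R y x) y = L x y"
proof -
  have "R (L (R y x) y) (L x y) = L (R y x) y"
    using braid_snd[of x y y] assms by simp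
  then have "R (L (R y x) y) (L x y) = R (L (R y x) y) (L (R y x) y)"
    using assms by simp
  then show ?thesis
    using assms R_eq_iff[of "L (R y x) y" "L x y" "L (R y x) y"] by simp
qed

text \<open>The cyclic condition for the pair \<open>(L x y, R y x)\<close>, which \<open>r\<close> sends back to \<open>(x, y)\<close>, replaces
  \<open>L (L x y)\<close> by \<open>L y\<close> in the involutivity relation. So \<open>R y\<close> is the inverse of \<open>L y\<close>.\<close>
lemma L_R_cancel [simp]:
  assumes "x \<in> X" "y \<in> X"
  shows "L y (R y x) = x"
proof -
  have "L y (R y x) = L (L x y) (R y x)"
    using cyclic_condition[of "L x y" "R y x"] assms by (simp add: R_involutive)
  then show ?thesis
    using assms by (simp add: L_involutive)
qed

lemma R_cong:
  assumes "x \<in> X" "y \<in> X" "z \<in> X" and "\<And>u. u \<in> X \<Longrightarrow> L y u = L z u"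
  shows "R y x = R z x"
proof -
  have "L z (R y x) = x"
    using assms L_R_cancel[of x y] by (metis R_in)
  then show ?thesis
    using assms by (metis L_R_cancel L_eq_iff R_in)
qed

text \<open>The relation \<open>\<sim>\<close> is a congruence for the left action. In the braid relation
  \<open>L x (L y v) = L (L x y) (L (R y x) v)\<close>, everything except \<open>L (L x y)\<close> depends on \<open>y\<close> only through
  \<open>L y\<close>, because \<open>R y\<close> is inverse to \<open>L y\<close>.\<close>
lemma L_L_cong:
  assumes "x \<in> X" "y \<in> X" "z \<in> X" and eq: "\<And>u. u \<in> X \<Longrightarrow> L y u = L z u" and "u \<in> X"
  shows "L (L x y) u = L (L x z) u"
proof -
  \<comment> \<open>The preimage of \<open>u\<close> under \<open>L (R y x)\<close>, so that the braid relation reads \<open>L (L x y) u = L x (L y v)\<close>.\<close>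
  let ?v = "R (R y x) u"
  have v: "?v \<in> X" "L (R y x) ?v = u"
    using assms by auto
  have "L (L x y) u = L x (L y ?v)"
    using braid_fst[of x y ?v] v assms by simp
  also have "\<dots> = L (L x z) (L (R z x) ?v)"
    using braid_fst[of x z ?v] v assms by simp
  also have "R z x = R y x"
    using R_cong[OF assms(1,3,2)] eq by simp
  finally show ?thesis
    using v by simp
qed

lemma equiv_ret_rel: "equiv X (ret_rel X r)"
  by (rule equivI) (auto simp: ret_rel_def refl_on_def sym_on_def trans_on_def)

lemma ret_rel_iff: "(x, y) \<in> ret_rel X r \<longleftrightarrow> x \<in> X \<and> y \<in> X \<and> (\<forall>z\<in>X. L x z = L y z)"
  by (simp add: ret_rel_def)

text \<open>By the congruence property, the unions in the definition of the retraction are unions of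
  equal classes.\<close>
lemma lact_ret_map:
  assumes "x \<in> X" "y \<in> X"
  shows "lact (ret_map X r) (ret_rel X r `` {x}) (ret_rel X r `` {y}) = ret_rel X r `` {L x y}"
proof -
  have "ret_rel X r `` {fst (r (x', y'))} = ret_rel X r `` {L x y}"
    if "x' \<in> ret_rel X r `` {x}" "y' \<in> ret_rel X r `` {y}" for x' y'
  proof -
    have *: "x' \<in> X" "y' \<in> X" "\<forall>z\<in>X. L x z = L x' z" "\<forall>z\<in>X. L y z = L y' z"
      using that by (auto simp: ret_rel_iff)
    then have "(L x y, L x' y') \<in> ret_rel X r"
      using assms L_L_cong[of x y y'] by (auto simp: ret_rel_iff)
    then show ?thesis
      using equiv_class_eq[OF equiv_ret_rel] by (simp add: r_eq)
  qed
  then have "(\<Union>x'\<in>ret_rel X r `` {x}. \<Union>y'\<in>ret_rel X r `` {y}. ret_rel X r `` {fst (r (x', y'))})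
      = (\<Union>x'\<in>ret_rel X r `` {x}. \<Union>y'\<in>ret_rel X r `` {y}. ret_rel X r `` {L x y})"
    by (intro SUP_cong refl)
  also have "\<dots> = ret_rel X r `` {L x y}"
  proof -
    have "ret_rel X r `` {x} \<noteq> {}" "ret_rel X r `` {y} \<noteq> {}"
      using assms by (auto simp: ret_rel_iff)
    then show ?thesis
      by simp
  qed
  finally show ?thesis
    by (simp add: lact_def ret_map_def)
qed

text \<open>Since the second retract is a point, all classes act in the same way on the first retract. So
  \<open>[L x y] = [L y y]\<close>, and \<open>L y y = y\<close> by square-freeness.\<close>
lemma L_L_eq [simp]:
  assumes "x \<in> X" "y \<in> X" "z \<in> X"
  shows "L (L x y) z = L y z"
proof -
  let ?c = "\<lambda>x. ret_rel X r `` {x}"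
  let ?S = "ret_rel (ret_set X r) (ret_map X r)"
  have c: "?c u \<in> ret_set X r" if "u \<in> X" for u
    using that by (auto simp: ret_set_def quotientI)
  have "is_singleton (ret_set X r // ?S)"
    using level_2 by (simp add: mpl_level_2_def ret_set_def)
  then have "?S `` {?c x} = ?S `` {?c y}"
    using quotientI[OF c, of x ?S] quotientI[OF c, of y ?S] assms
    by (auto simp: is_singleton_def)
  moreover have "?c y \<in> ?S `` {?c y}"
    using c assms by (simp add: ret_rel_def[of "ret_set X r"])
  ultimately have "?c y \<in> ?S `` {?c x}"
    by simp
  then have "lact (ret_map X r) (?c x) (?c y) = lact (ret_map X r) (?c y) (?c y)"
    using c assms by (simp add: ret_rel_def[of "ret_set X r"])
  then have "?c (L x y) = ?c y"
    using assms by (simp add: lact_ret_map)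
  then have "(L x y, y) \<in> ret_rel X r"
    using assms equiv_class_eq_iff[OF equiv_ret_rel] by blast
  then show ?thesis
    using assms by (simp add: ret_rel_iff)
qed

lemma L_R_eq:
  assumes "x \<in> X" "y \<in> X" "z \<in> X"
  shows "L (R y x) z = L x z"
  using L_L_eq[of y "R y x" z] assms by simp

lemma L_commute:
  assumes "x \<in> X" "y \<in> X" "z \<in> X"
  shows "L x (L y z) = L y (L x z)"
  using braid_fst[of x y z] assms by (simp add: L_R_eq)

end

section \<open>Orbits and the group acting on the symmetric algebra\<close>

text \<open>Centralizers are subgroups; the generated subgroup centralizes first \<open>S\<close> and then itself.\<close>
lemma (in group) comm_group_subgroup_generated:
  assumes "S \<subseteq> carrier G" and "\<And>a b. a \<in> S \<Longrightarrow> b \<in> S \<Longrightarrow> a \<otimes> b = b \<otimes> a"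
  shows "comm_group (subgroup_generated G S)"
proof -
  let ?C = "\<lambda>A. {g \<in> carrier G. \<forall>a\<in>A. g \<otimes> a = a \<otimes> g}"
  have sub: "subgroup (?C A) G" if "A \<subseteq> carrier G" for A
  proof (rule subgroupI)
    show "inv g \<in> ?C A" if "g \<in> ?C A" for g
    proof -
      have "inv g \<otimes> a = a \<otimes> inv g" if "a \<in> A" for a
      proof -
        have *: "a \<in> carrier G" "g \<in> carrier G" "g \<otimes> a = a \<otimes> g"
          using \<open>a \<in> A\<close> \<open>A \<subseteq> carrier G\<close> \<open>g \<in> ?C A\<close> by auto
        then have "inv g \<otimes> a = inv g \<otimes> (a \<otimes> g) \<otimes> inv g"
          by (simp add: m_assoc)
        also have "\<dots> = a \<otimes> inv g"
          using * by (simp add: m_assoc [symmetric] flip: \<open>g \<otimes> a = a \<otimes> g\<close>)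
        finally show ?thesis .
      qed
      then show ?thesis
        using \<open>g \<in> ?C A\<close> by auto
    qed
    show "g \<otimes> h \<in> ?C A" if "g \<in> ?C A" "h \<in> ?C A" for g h
    proof -
      have "g \<otimes> h \<otimes> a = a \<otimes> (g \<otimes> h)" if "a \<in> A" for a
      proof -
        have *: "a \<in> carrier G" "g \<in> carrier G" "g \<otimes> a = a \<otimes> g" "h \<in> carrier G" "h \<otimes> a = a \<otimes> h"
          using \<open>a \<in> A\<close> \<open>A \<subseteq> carrier G\<close> \<open>g \<in> ?C A\<close> \<open>h \<in> ?C A\<close> by auto
        then show ?thesis
          by (metis m_assoc)
      qed
      then show ?thesis
        using that by auto
    qed
  qed (use that in \<open>auto simp: subset_iff intro!: exI[of _ \<one>]\<close>)
  let ?S = "carrier (subgroup_generated G S)"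
  have "?S \<subseteq> ?C S"
    using assms by (intro subgroup_generated_minimal sub) auto
  then have "S \<subseteq> ?C ?S"
    using assms(1) by (auto simp: subset_iff)
  then have "?S \<subseteq> ?C ?S"
    by (intro subgroup_generated_minimal sub carrier_subgroup_generated_subset)
  then show ?thesis
    by (intro group.group_comm_groupI) auto
qed

lemma Bij_mult: "f \<in> Bij S \<Longrightarrow> g \<in> Bij S \<Longrightarrow> f \<otimes>\<^bsub>BijGroup S\<^esub> g = compose S f g"
  and carrier_BijGroup: "carrier (BijGroup S) = Bij S"
  and one_BijGroup: "\<one>\<^bsub>BijGroup S\<^esub> = (\<lambda>x\<in>S. x)"
  by (simp_all add: BijGroup_def)

lemma restrict_Bij: "bij_betw f S S \<Longrightarrow> restrict f S \<in> Bij S"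
  by (simp add: Bij_def bij_betw_def inj_on_def)

context level2_solution
begin

lemma carrier_perm_group: "carrier (perm_group X r) \<subseteq> Bij X"
  unfolding perm_group_def
  using group.carrier_subgroup_generated_subset[OF group_BijGroup] by (auto simp: carrier_BijGroup)

lemma group_action_perm_group: "group_action (perm_group X r) X (\<lambda>g. g)"
proof -
  have "(\<lambda>g. g) \<in> hom (perm_group X r) (BijGroup X)"
    using carrier_perm_group by (auto simp: hom_def perm_group_def carrier_BijGroup)
  then show ?thesis
    unfolding group_action_def group_hom_def group_hom_axioms_def
    by (simp add: group_BijGroup perm_group_def group.group_subgroup_generated)
qed

lemma L_perm_group: "x \<in> X \<Longrightarrow> restrict (L x) X \<in> carrier (perm_group X r)"
  unfolding perm_group_def
  by (rule subsetD[OF group.subgroup_generated_subset_carrier_subset[OF group_BijGroup]])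
    (auto simp: carrier_BijGroup intro: restrict_Bij L_bij)

lemma orb_of_refl [simp]: "x \<in> X \<Longrightarrow> x \<in> orb_of X r x"
  unfolding orb_of_def by (rule group_action.orbit_refl[OF group_action_perm_group])

lemma orb_of_subset: "x \<in> X \<Longrightarrow> orb_of X r x \<subseteq> X"
  using carrier_perm_group Bij_imp_funcset by (fastforce simp: orb_of_def orbit_def)

lemma orb_of_eq:
  assumes "x \<in> X" "y \<in> orb_of X r x"
  shows "orb_of X r y = orb_of X r x"
proof -
  interpret group_action "perm_group X r" X "\<lambda>g. g"
    by (rule group_action_perm_group)
  have y: "y \<in> X"
    using assms orb_of_subset by blast
  have "orb_of X r y \<in> orbs X r" "orb_of X r x \<in> orbs X r"
    using assms y by (auto simp: orbs_def orbits_def orb_of_def)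
  then have "orb_of X r y = orb_of X r x \<or> orb_of X r y \<inter> orb_of X r x = {}"
    unfolding orbs_def by (rule disjoint_union)
  then show ?thesis
    using assms(2) orb_of_refl[OF y] by blast
qed

lemma L_in_orb: "x \<in> X \<Longrightarrow> z \<in> X \<Longrightarrow> L z x \<in> orb_of X r x"
  using L_perm_group[of z] unfolding orb_of_def orbit_def
  by (intro CollectI exI[of _ "restrict (L z) X"]) simp

lemma orb_of_L [simp]: "x \<in> X \<Longrightarrow> z \<in> X \<Longrightarrow> orb_of X r (L z x) = orb_of X r x"
  using orb_of_eq L_in_orb by blast

lemma orbs_eq: "orbs X r = orb_of X r ` X"
  by (auto simp: orbs_def orb_of_def orbits_def)

lemma orbsE:
  assumes "i \<in> orbs X r"
  obtains x where "x \<in> X" "i = orb_of X r x"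
  using assms by (auto simp: orbs_eq)

lemma orbs_subset: "i \<in> orbs X r \<Longrightarrow> i \<subseteq> X"
  using orb_of_subset by (auto simp: orbs_eq)

lemma orb_of_member: "i \<in> orbs X r \<Longrightarrow> y \<in> i \<Longrightarrow> orb_of X r y = i"
  using orb_of_eq by (metis orbsE)

text \<open>The permutations \<open>g\<close> with \<open>L (g x) = L x\<close> for all \<open>x\<close> form a subgroup, which contains the
  generators \<open>L u\<close> by \<open>L_L_eq\<close>.\<close>
lemma L_orbit_cong:
  assumes "x \<in> X" "y \<in> orb_of X r x" "z \<in> X"
  shows "L y z = L x z"
proof -
  let ?H = "{g \<in> Bij X. \<forall>x\<in>X. \<forall>z\<in>X. L (g x) z = L x z}"
  interpret group "BijGroup X"
    by (rule group_BijGroup)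
  have "subgroup ?H (BijGroup X)"
  proof (rule subgroupI)
    show "?H \<noteq> {}"
      by (rule ex_in_conv[THEN iffD1], rule exI[of _ "\<lambda>x\<in>X. x"]) (simp add: id_Bij)
    show "inv\<^bsub>BijGroup X\<^esub> g \<in> ?H" if "g \<in> ?H" for g
    proof -
      have g: "bij_betw g X X" "g \<in> Bij X" "\<And>x z. x \<in> X \<Longrightarrow> z \<in> X \<Longrightarrow> L (g x) z = L x z"
        using that by (auto simp: Bij_def)
      have "L (inv_into X g x) z = L x z" if "x \<in> X" "z \<in> X" for x z
        using g(3)[of "inv_into X g x" z] that g(1)
        by (metis bij_betw_inv_into_right bij_betw_imp_surj_on inv_into_into)
      then show ?thesis
        using g by (simp add: inv_BijGroup restrict_inv_into_Bij)
    qed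
    show "g \<otimes>\<^bsub>BijGroup X\<^esub> h \<in> ?H" if "g \<in> ?H" "h \<in> ?H" for g h
      using that Bij_imp_funcset[of h X] compose_Bij[of g X h]
      by (auto simp: Bij_mult compose_def[of X g h] Pi_iff)
  qed (auto simp: carrier_BijGroup)
  moreover have "(\<lambda>x. restrict (L x) X) ` X \<subseteq> ?H"
    by (auto intro: restrict_Bij L_bij)
  ultimately have "carrier (perm_group X r) \<subseteq> ?H"
    unfolding perm_group_def by (rule subgroup_generated_minimal)
  moreover obtain g where "g \<in> carrier (perm_group X r)" "y = g x"
    using assms by (auto simp: orb_of_def orbit_def)
  ultimately have "g \<in> ?H" "y = g x"
    by (simp_all only: subset_iff)
  then show ?thesis
    using assms by simp
qed

lemma L_bij_orbit:
  assumes "x \<in> X" "i \<in> orbs X r"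
  shows "bij_betw (L x) i i"
proof -
  have sub: "i \<subseteq> X"
    using assms orbs_subset by blast
  then have "inj_on (L x) i"
    using assms by (auto simp: inj_on_def subset_iff)
  moreover have "L x ` i \<subseteq> i"
  proof (rule image_subsetI)
    fix y
    assume "y \<in> i"
    then show "L x y \<in> i"
      using L_in_orb[of y x] orb_of_member[OF assms(2)] assms(1) sub by auto
  qed
  ultimately show ?thesis
    using finite_subset[OF sub finite_X] by (simp add: bij_betw_def endo_inj_surj)
qed

lemma carrier_orb_group: "carrier (orb_group X r i) \<subseteq> Bij i"
  unfolding orb_group_def
  using group.carrier_subgroup_generated_subset[OF group_BijGroup] by (auto simp: carrier_BijGroup)

lemma group_orb_group: "group (orb_group X r i)"
  by (simp add: orb_group_def group.group_subgroup_generated group_BijGroup)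

lemma comm_group_orb_group:
  assumes "i \<in> orbs X r"
  shows "comm_group (orb_group X r i)"
  unfolding orb_group_def
proof (rule group.comm_group_subgroup_generated[OF group_BijGroup])
  have B: "restrict (L x) i \<in> Bij i" if "x \<in> X" for x
    by (rule restrict_Bij[OF L_bij_orbit[OF that assms]])
  then show "(\<lambda>x. restrict (L x) i) ` X \<subseteq> carrier (BijGroup i)"
    by (auto simp: carrier_BijGroup)
  have comp: "compose i (restrict (L x) i) (restrict (L y) i) = compose i (restrict (L y) i) (restrict (L x) i)"
    if "x \<in> X" "y \<in> X" for x y
    using that L_bij_orbit[OF _ assms, THEN bij_betwE] L_commute[OF that] orbs_subset[OF assms]
    by (auto simp: compose_def fun_eq_iff)
  show "a \<otimes>\<^bsub>BijGroup i\<^esub> b = b \<otimes>\<^bsub>BijGroup i\<^esub> a"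
    if "a \<in> (\<lambda>x. restrict (L x) i) ` X" "b \<in> (\<lambda>x. restrict (L x) i) ` X" for a b
    using that(1)
  proof (rule imageE)
    fix x
    assume x: "a = restrict (L x) i" "x \<in> X"
    show ?thesis
      using that(2)
    proof (rule imageE)
      fix y
      assume "b = restrict (L y) i" "y \<in> X"
      then show ?thesis
        using x B by (simp add: Bij_mult comp)
    qed
  qed
qed

lemma comm_group_calH: "comm_group (calH X r)"
proof -
  have "group (calH X r)"
    unfolding calH_def by (rule product_group) (rule group_orb_group)
  then show ?thesis
  proof (rule group.group_comm_groupI)
    fix f g
    assume "f \<in> carrier (calH X r)" "g \<in> carrier (calH X r)"
    then have "f i \<otimes>\<^bsub>orb_group X r i\<^esub> g i = g i \<otimes>\<^bsub>orb_group X r i\<^esub> f i" if "i \<in> orbs X r" for i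
      using that comm_groupE(4)[OF comm_group_orb_group[OF that]] by (auto simp: calH_def)
    then show "f \<otimes>\<^bsub>calH X r\<^esub> g = g \<otimes>\<^bsub>calH X r\<^esub> f"
      by (auto simp: calH_def)
  qed
qed

lemma finite_calH: "finite (carrier (calH X r))"
proof -
  have "finite (carrier (orb_group X r i))" if "i \<in> orbs X r" for i
  proof -
    have "Bij i \<subseteq> i \<rightarrow>\<^sub>E i"
      by (rule subsetI) (simp add: PiE_def Bij_imp_extensional Bij_imp_funcset)
    moreover have "finite (i \<rightarrow>\<^sub>E i)"
      using finite_subset[OF orbs_subset[OF that] finite_X] by (auto intro: finite_PiE)
    ultimately show ?thesis
      using carrier_orb_group finite_subset by metis
  qed
  then show ?thesis
    using finite_X by (auto simp: calH_def orbs_eq intro!: finite_PiE)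
qed

sublocale H: comm_group "calH X r"
  by (rule comm_group_calH)

text \<open>The permutation of \<open>X\<close> whose restriction to each orbit is the corresponding component of \<open>h\<close>.\<close>
definition act :: "'a calH_elt \<Rightarrow> 'a \<Rightarrow> 'a" where
  "act h x = h (orb_of X r x) x"

lemma orb_of_in_orbs [simp]: "x \<in> X \<Longrightarrow> orb_of X r x \<in> orbs X r"
  by (simp add: orbs_eq)

lemma calH_component:
  assumes "h \<in> carrier (calH X r)" "i \<in> orbs X r"
  shows "h i \<in> Bij i"
  using assms carrier_orb_group by (auto simp: calH_def)

lemma act_in_orb:
  assumes "h \<in> carrier (calH X r)" "x \<in> X"
  shows "act h x \<in> orb_of X r x"
  using Bij_imp_funcset[OF calH_component[OF assms(1) orb_of_in_orbs[OF assms(2)]]] assms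
  by (auto simp: act_def)

lemma act_in [simp, intro]: "h \<in> carrier (calH X r) \<Longrightarrow> x \<in> X \<Longrightarrow> act h x \<in> X"
  using act_in_orb orb_of_subset by blast

lemma orb_of_act [simp]:
  "h \<in> carrier (calH X r) \<Longrightarrow> x \<in> X \<Longrightarrow> orb_of X r (act h x) = orb_of X r x"
  using act_in_orb orb_of_eq by blast

lemma act_mult:
  assumes "g \<in> carrier (calH X r)" "h \<in> carrier (calH X r)" "x \<in> X"
  shows "act (g \<otimes>\<^bsub>calH X r\<^esub> h) x = act g (act h x)"
proof -
  let ?i = "orb_of X r x"
  have "(g \<otimes>\<^bsub>calH X r\<^esub> h) ?i = compose ?i (g ?i) (h ?i)"
    using assms Bij_mult[OF calH_component[OF assms(1)] calH_component[OF assms(2)], of ?i]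
    by (simp add: calH_def orb_group_def)
  then show ?thesis
    using assms orb_of_act[OF assms(2,3)] by (simp add: act_def compose_def)
qed

lemma act_one [simp]: "x \<in> X \<Longrightarrow> act \<one>\<^bsub>calH X r\<^esub> x = x"
  by (simp add: act_def calH_def orb_group_def one_BijGroup)

text \<open>The definite description in \<^const>\<open>sigma\<close> is proper because \<open>L\<close> is constant on orbits.\<close>
lemma gam_eq:
  assumes "z \<in> X"
  shows "gam X r (orb_of X r z) = (\<lambda>j\<in>orbs X r. restrict (L z) j)"
proof -
  have "sigma r (orb_of X r z) j = restrict (L z) j" if "j \<in> orbs X r" for j
  proof -
    have "restrict (L x) j = restrict (L z) j" if "x \<in> orb_of X r z" for x
      using L_orbit_cong[OF assms that] orbs_subset[OF \<open>j \<in> orbs X r\<close>]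
      by (auto simp: restrict_def fun_eq_iff)
    then show ?thesis
      unfolding sigma_def using orb_of_refl[OF assms] by (intro the_equality) metis+
  qed
  then show ?thesis
    by (auto simp: gam_def restrict_def fun_eq_iff)
qed

lemma gam_in_calH [simp, intro]: "z \<in> X \<Longrightarrow> gam X r (orb_of X r z) \<in> carrier (calH X r)"
  unfolding gam_eq calH_def carrier_product_group orb_group_def
  by (rule restrict_PiE_iff[THEN iffD2])
    (auto intro!: subsetD[OF group.subgroup_generated_subset_carrier_subset[OF group_BijGroup]]
      restrict_Bij L_bij_orbit simp: carrier_BijGroup)

lemma act_gam: "z \<in> X \<Longrightarrow> x \<in> X \<Longrightarrow> act (gam X r (orb_of X r z)) x = L z x"
  by (simp add: act_def gam_eq)

end

section \<open>Linear maps between spaces of finitely supported functions\<close>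
lemma lookup_cscale [simp]: "Poly_Mapping.lookup (cscale c f) k = c * Poly_Mapping.lookup f k"
  by (simp add: cscale_def Poly_Mapping.map.rep_eq when_def)

interpretation cspace: vector_space cscale
  by unfold_locales (auto intro!: poly_mapping_eqI simp: lookup_add algebra_simps)

lemma cscale_single [simp]: "cscale c (Poly_Mapping.single k a) = Poly_Mapping.single k (c * a)"
  by (rule poly_mapping_eqI) (simp add: lookup_single when_def)

lemma keys_cscale_subset: "Poly_Mapping.keys (cscale c f) \<subseteq> Poly_Mapping.keys f"
  by (auto simp: in_keys_iff)

lemma sum_singles:
  fixes f :: "'b \<Rightarrow>\<^sub>0 'c::comm_monoid_add"
  shows "(\<Sum>k\<in>Poly_Mapping.keys f. Poly_Mapping.single k (Poly_Mapping.lookup f k)) = f"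
  by (rule poly_mapping_eqI)
    (auto simp: lookup_sum lookup_single when_def in_keys_iff sum.delta' cong: sum.cong)

lemma keys_monomial_add: "Poly_Mapping.keys (m + n) = Poly_Mapping.keys m \<union> Poly_Mapping.keys n"
  for m n :: "'a \<Rightarrow>\<^sub>0 nat"
  by (auto simp: in_keys_iff lookup_add)

abbreviation clinear :: "(('b \<Rightarrow>\<^sub>0 complex) \<Rightarrow> ('c \<Rightarrow>\<^sub>0 complex)) \<Rightarrow> bool" where
  "clinear \<equiv> Vector_Spaces.linear cscale cscale"

lemma clinearI:
  assumes "\<And>f g. F (f + g) = F f + F g" and "\<And>c f. F (cscale c f) = cscale c (F f)"
  shows "clinear F"
  using assms by (simp add: Vector_Spaces.linear_iff cspace.vector_space_axioms)

lemma clinear_add: "clinear F \<Longrightarrow> F (f + g) = F f + F g"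
  and clinear_scale: "clinear F \<Longrightarrow> F (cscale c f) = cscale c (F f)"
  by (simp_all add: Vector_Spaces.linear_iff)

lemma clinear_0: "clinear F \<Longrightarrow> F 0 = 0"
  using clinear_scale[of F 0 0] by simp

lemma clinear_sum: "clinear F \<Longrightarrow> F (sum f A) = (\<Sum>a\<in>A. F (f a))"
  by (induction A rule: infinite_finite_induct) (auto simp: clinear_0 clinear_add)

lemma clinear_diff: "clinear F \<Longrightarrow> F (f - g) = F f - F g"
  using clinear_add[of F "f - g" g] by (simp add: algebra_simps)

lemma clinear_expansion:
  assumes "clinear F"
  shows "F f = lin_ext (\<lambda>k. F (Poly_Mapping.single k 1)) f"
proof -
  have "F f = F (\<Sum>k\<in>Poly_Mapping.keys f. cscale (Poly_Mapping.lookup f k) (Poly_Mapping.single k 1))"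
    by (simp add: sum_singles)
  then show ?thesis
    by (simp only: clinear_sum[OF assms] clinear_scale[OF assms] lin_ext_def)
qed

lemma clinear_eqI:
  assumes "clinear F" "clinear G"
    and "\<And>k. k \<in> Poly_Mapping.keys f \<Longrightarrow> F (Poly_Mapping.single k 1) = G (Poly_Mapping.single k 1)"
  shows "F f = G f"
  unfolding clinear_expansion[OF assms(1), of f] clinear_expansion[OF assms(2), of f]
  using assms(3) by (simp add: lin_ext_def)

lemma lin_ext_superset:
  assumes "finite A" "Poly_Mapping.keys v \<subseteq> A"
  shows "lin_ext f v = (\<Sum>k\<in>A. cscale (Poly_Mapping.lookup v k) (f k))"
  unfolding lin_ext_def using assms by (intro sum.mono_neutral_left) (auto simp: in_keys_iff)

lemma clinear_lin_ext:
  fixes f :: "'b \<Rightarrow> ('c \<Rightarrow>\<^sub>0 complex)"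
  shows "clinear (lin_ext f)"
proof (rule clinearI)
  fix v w :: "'b \<Rightarrow>\<^sub>0 complex"
  let ?A = "Poly_Mapping.keys v \<union> Poly_Mapping.keys w"
  have "lin_ext f (v + w) = (\<Sum>k\<in>?A. cscale (Poly_Mapping.lookup (v + w) k) (f k))"
    by (rule lin_ext_superset) (simp_all add: keys_add)
  also have "\<dots> = lin_ext f v + lin_ext f w"
    by (simp add: lin_ext_superset[of ?A] lookup_add cspace.scale_left_distrib sum.distrib)
  finally show "lin_ext f (v + w) = lin_ext f v + lin_ext f w" .
next
  fix c v
  show "lin_ext f (cscale c v) = cscale c (lin_ext f v)"
    by (subst lin_ext_superset[OF finite_keys keys_cscale_subset])
      (simp add: lin_ext_def cspace.scale_sum_right)
qed

lemma lin_ext_single [simp]: "lin_ext f (Poly_Mapping.single k c) = cscale c (f k)"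
  by (cases "c = 0") (simp_all add: lin_ext_def)

lemma clinear_compose: "clinear F \<Longrightarrow> clinear G \<Longrightarrow> clinear (\<lambda>f. F (G f))"
  by (rule clinearI) (simp_all add: clinear_add clinear_scale)

lemma clinear_cscale: "clinear F \<Longrightarrow> clinear (\<lambda>f. cscale c (F f))"
  by (rule clinearI) (simp_all add: clinear_add clinear_scale cspace.scale_right_distrib mult.commute)

lemma clinear_ident: "clinear (\<lambda>f. f)"
  by (rule clinearI) simp_all

text \<open>If the images of the basis vectors depend linearly on a parameter, so does the linear
  extension. This yields linearity of products in their second argument.\<close>
lemma clinear_lin_ext_coeff:
  assumes "\<And>k. clinear (\<lambda>v. F v k)"
  shows "clinear (\<lambda>v. lin_ext (F v) u)"
  unfolding lin_ext_def
  by (rule clinearI)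
    (simp_all add: clinear_add[OF assms] clinear_scale[OF assms] cspace.scale_right_distrib
      sum.distrib cspace.scale_sum_right mult.commute)

lemma clinear_span_into:
  assumes "clinear F" "cspace.subspace P" "\<And>b. b \<in> B \<Longrightarrow> F b \<in> P" "v \<in> cspace.span B"
  shows "F v \<in> P"
proof -
  have "cspace.subspace {v. F v \<in> P}"
    using assms(1,2)
    by (auto simp: cspace.subspace_def clinear_0 clinear_add clinear_scale)
  then have "cspace.span B \<subseteq> {v. F v \<in> P}"
    using assms(3) by (intro cspace.span_minimal) auto
  then show ?thesis
    using assms(4) by auto
qed

section \<open>Joint eigenvectors of commuting operators of finite order\<close>
lemma sum_powers_root_of_unity:
  fixes k n :: nat
  assumes "n > 0" "k < n"
  shows "(\<Sum>j<n. inverse (cis (2 * pi * real j / real n)) ^ k) = (if k = 0 then of_nat n else 0)"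
proof (cases "k = 0")
  case False
  define w where "w = inverse (cis (2 * pi * real k / real n))"
  have "cis (2 * pi * real k / real n) \<noteq> cis (2 * pi * real 0 / real n)"
    using inj_onD[OF bij_betw_imp_inj_on[OF bij_betw_roots_unity[OF assms(1)]], of k 0] assms False
    by auto
  then have "cis (2 * pi * real k / real n) \<noteq> 1"
    by simp
  then have w: "w \<noteq> 1"
    unfolding w_def by (simp only: inverse_eq_1_iff not_False_eq_True)
  have "cis (2 * pi * real k / real n) ^ n = cis (2 * pi * real k)"
    using assms by (simp add: DeMoivre)
  then have "w ^ n = inverse (cis (2 * pi * real k))"
    by (simp only: w_def power_inverse)
  also have "\<dots> = 1"
    by (simp only: cis_multiple_2pi Ints_of_nat inverse_1)
  finally have "(\<Sum>j<n. w ^ j) = 0"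
    using w by (simp add: geometric_sum)
  moreover have "inverse (cis (2 * pi * real j / real n)) ^ k = w ^ j" for j
    by (simp add: w_def power_inverse DeMoivre algebra_simps)
  ultimately show ?thesis
    using False by simp
qed simp

text \<open>The vectors \<open>P j\<close> are the projections of \<open>w\<close> to the eigenspaces of the \<open>n\<close>-th roots of unity
  \<open>\<zeta> j\<close>, namely the averages of \<open>\<zeta> j\<^sup>-\<^sup>k T\<^sup>k w\<close>. They are stated as combinations of the iterates of \<open>w\<close>,
  since this shows that they stay in every invariant subspace and that operators commuting with
  \<open>T\<close> treat them like \<open>w\<close>.\<close>
lemma finite_order_eigen_decomposition:
  assumes T: "clinear T" and n: "n > 0" and Tn: "(T ^^ n) w = w"
  obtains P :: "nat \<Rightarrow> 'b \<Rightarrow>\<^sub>0 complex" and c :: "nat \<Rightarrow> nat \<Rightarrow> complex" and \<zeta> :: "nat \<Rightarrow> complex"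
  where "w = (\<Sum>j<n. P j)" "\<And>j. T (P j) = cscale (\<zeta> j) (P j)"
    "\<And>j. P j = (\<Sum>k<n. cscale (c j k) ((T ^^ k) w))"
proof -
  define \<zeta> where "\<zeta> j = cis (2 * pi * real j / real n)" for j
  define c where "c j k = inverse (of_nat n) * inverse (\<zeta> j) ^ k" for j k
  define P where "P j = (\<Sum>k<n. cscale (c j k) ((T ^^ k) w))" for j
  have \<zeta>: "\<zeta> j ^ n = 1" "\<zeta> j \<noteq> 0" for j
    using n by (simp_all add: \<zeta>_def DeMoivre cis_multiple_2pi)
  show thesis
  proof
    have "(\<Sum>j<n. P j) = (\<Sum>k<n. \<Sum>j<n. cscale (c j k) ((T ^^ k) w))"
      unfolding P_def by (rule sum.swap)
    also have "\<dots> = (\<Sum>k<n. cscale (\<Sum>j<n. c j k) ((T ^^ k) w))"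
      by (simp add: cspace.scale_sum_left)
    also have "\<dots> = (\<Sum>k<n. if k = 0 then w else 0)"
    proof (intro sum.cong refl)
      fix k
      assume "k \<in> {..<n}"
      then have "(\<Sum>j<n. c j k) = (if k = 0 then 1 else 0)"
        unfolding c_def \<zeta>_def sum_distrib_left[symmetric] using n
        by (simp only: sum_powers_root_of_unity lessThan_iff) simp
      then show "cscale (\<Sum>j<n. c j k) ((T ^^ k) w) = (if k = 0 then w else 0)"
        by simp
    qed
    also have "\<dots> = w"
      using n by simp
    finally show "w = (\<Sum>j<n. P j)" ..
  next
    fix j
    have step: "cscale (c j k) ((T ^^ Suc k) w) = cscale (\<zeta> j) (cscale (c j (Suc k)) ((T ^^ Suc k) w))" for k
      using \<zeta> by (simp add: c_def)
    \<comment> \<open>The coefficients are periodic in the exponent, so shifting the summation index is harmless.\<close>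
    have wrap: "cscale (c j n) ((T ^^ n) w) = cscale (c j 0) ((T ^^ 0) w)"
      using \<zeta> Tn by (simp add: c_def power_inverse)
    have "T (P j) = (\<Sum>k<n. cscale (c j k) ((T ^^ Suc k) w))"
      by (simp add: P_def clinear_sum[OF T] clinear_scale[OF T])
    also have "\<dots> = cscale (\<zeta> j) (\<Sum>k<n. cscale (c j (Suc k)) ((T ^^ Suc k) w))"
      by (simp only: step cspace.scale_sum_right)
    also have "(\<Sum>k<n. cscale (c j (Suc k)) ((T ^^ Suc k) w)) = P j"
      using sum.lessThan_Suc_shift[of "\<lambda>k. cscale (c j k) ((T ^^ k) w)" n] wrap
      by (simp add: P_def)
    finally show "T (P j) = cscale (\<zeta> j) (P j)" .
  qed (simp add: P_def)
qed

text \<open>Adding one operator \<open>T h\<close> at a time: a joint eigenvector of the earlier operators is the sum of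
  its projections to the eigenspaces of \<open>T h\<close>, and these remain eigenvectors of the earlier ones.\<close>
lemma joint_eigen_decomposition:
  fixes T :: "'g \<Rightarrow> ('b \<Rightarrow>\<^sub>0 complex) \<Rightarrow> 'b \<Rightarrow>\<^sub>0 complex"
  assumes "finite S" "cspace.subspace W"
    and lin: "\<And>g. g \<in> S \<Longrightarrow> clinear (T g)"
    and W: "\<And>g w. g \<in> S \<Longrightarrow> w \<in> W \<Longrightarrow> T g w \<in> W"
    and comm: "\<And>g h w. g \<in> S \<Longrightarrow> h \<in> S \<Longrightarrow> w \<in> W \<Longrightarrow> T g (T h w) = T h (T g w)"
    and order: "\<And>g w. g \<in> S \<Longrightarrow> w \<in> W \<Longrightarrow> \<exists>n>0. (T g ^^ n) w = w"
    and "v \<in> W"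
  shows "v \<in> cspace.span {w \<in> W. \<forall>g\<in>S. \<exists>c. T g w = cscale c w}"
  using assms(1) lin W comm order
proof (induction S rule: finite_induct)
  case empty
  then show ?case
    using assms(7) by (auto intro: cspace.span_base)
next
  case (insert h S)
  let ?E = "\<lambda>S. {w \<in> W. \<forall>g\<in>S. \<exists>c. T g w = cscale c w}"
  have "w \<in> cspace.span (?E (insert h S))" if "w \<in> ?E S" for w
  proof -
    have w: "w \<in> W"
      using that by simp
    have lh: "clinear (T h)"
      using insert.prems(1) by simp
    obtain n where n: "n > 0" "(T h ^^ n) w = w"
      using insert.prems(4)[of h w] w by auto
    obtain P c \<zeta> where P: "w = (\<Sum>j<n. P j)" "\<And>j. T h (P j) = cscale (\<zeta> j) (P j)"
      "\<And>j. P j = (\<Sum>k<n. cscale (c j k) ((T h ^^ k) w))"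
      by (rule finite_order_eigen_decomposition[OF lh n]) (rule that)
    have pow: "(T h ^^ k) w \<in> W" for k
      by (induction k) (simp_all add: w insert.prems(2))
    have PW: "P j \<in> W" for j
      unfolding P(3)
      by (intro cspace.subspace_sum cspace.subspace_scale assms(2) pow)
    have "\<exists>a. T g (P j) = cscale a (P j)" if g: "g \<in> S" for g j
    proof -
      obtain a where a: "T g w = cscale a w"
        using \<open>w \<in> ?E S\<close> g by auto
      have lg: "clinear (T g)"
        using insert.prems(1) that by auto
      have "T g ((T h ^^ k) w) = cscale a ((T h ^^ k) w)" for k
        using insert.prems(3)[of g h, OF _ _ pow] that
        by (induction k) (simp_all add: a clinear_scale[OF lh])
      then have "T g (P j) = (\<Sum>k<n. cscale (c j k) (cscale a ((T h ^^ k) w)))"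
        by (simp add: P(3) clinear_sum[OF lg] clinear_scale[OF lg])
      also have "\<dots> = cscale a (P j)"
        by (simp add: P(3) cspace.scale_sum_right mult.commute)
      finally show ?thesis ..
    qed
    then have "P j \<in> ?E (insert h S)" for j
      using PW P(2) by auto
    then show ?thesis
      unfolding P(1) by (intro cspace.span_sum cspace.span_base)
  qed
  then have "cspace.span (?E S) \<subseteq> cspace.span (?E (insert h S))"
    by (intro cspace.span_minimal) auto
  moreover have "v \<in> cspace.span (?E S)"
    by (rule insert.IH) (use insert.prems in auto)
  ultimately show ?case
    by blast
qed

text \<open>The usual elimination: if \<open>T s\<close> has different eigenvalues on \<open>e d0\<close> and \<open>e d1\<close>, then applying
  \<open>T s - ev d0 s\<close> to the relation removes \<open>e d0\<close> and multiplies \<open>e d1\<close> by a nonzero scalar.\<close>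
lemma separated_eigenvectors_independent:
  fixes T :: "'s \<Rightarrow> ('b \<Rightarrow>\<^sub>0 complex) \<Rightarrow> 'b \<Rightarrow>\<^sub>0 complex"
  assumes "finite D" and "\<And>s. clinear (T s)"
    and "\<And>d s. d \<in> D \<Longrightarrow> T s (e d) = cscale (ev d s) (e d)"
    and "inj_on ev D"
    and "(\<Sum>d\<in>D. e d) = 0" and "d \<in> D"
  shows "e d = 0"
  using assms(1,3-)
proof (induction D arbitrary: e d rule: finite_induct)
  case (insert d0 D)
  have others: "e d1 = 0" if "d1 \<in> D" for d1
  proof -
    have "ev d1 \<noteq> ev d0"
      using insert.hyps insert.prems(2) that by (metis inj_onD insertCI)
    then obtain s where s: "ev d1 s \<noteq> ev d0 s"
      by auto
    \<comment> \<open>The image of \<open>e d\<close> under \<open>T s - ev d0 s\<close>.\<close>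
    define e' where "e' d = cscale (ev d s - ev d0 s) (e d)" for d
    have "(\<Sum>d\<in>insert d0 D. e' d) = T s (\<Sum>d\<in>insert d0 D. e d) - cscale (ev d0 s) (\<Sum>d\<in>insert d0 D. e d)"
      using insert.prems(1)
      by (simp add: e'_def clinear_sum[OF assms(2)] cspace.scale_sum_right cspace.scale_left_diff_distrib
          sum_subtractf del: sum.insert)
    also have "\<dots> = 0"
      by (simp add: insert.prems(3) clinear_0[OF assms(2)] del: sum.insert)
    finally have "(\<Sum>d\<in>D. e' d) = 0"
      using insert.hyps by (simp add: e'_def)
    moreover have "T t (e' d) = cscale (ev d t) (e' d)" if "d \<in> D" for d t
      using insert.prems(1) that by (simp add: e'_def clinear_scale[OF assms(2)] mult.commute)
    ultimately have "e' d1 = 0"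
      using insert.IH[of e' d1] insert.prems(2) that by auto
    then show ?thesis
      using s by (simp add: e'_def)
  qed
  then have "e d0 = 0"
    using insert.prems(3) insert.hyps by simp
  then show ?case
    using others insert.prems(4) by auto
qed simp

section \<open>Substitutions of variables in the symmetric algebra\<close>
lemma cscale_times: "cscale c f * g = cscale c (f * g)" "f * cscale c g = cscale c (f * g)"
  for f g :: "'a cpoly"
  by (simp_all add: cscale_def mult_map_scale_conv_mult mult.assoc mult.left_commute)

lemma clinear_times_right: "clinear F \<Longrightarrow> clinear (\<lambda>f. F f * g)"
  and clinear_times_left: "clinear F \<Longrightarrow> clinear (\<lambda>f. g * F f)"
  for g :: "'a cpoly"
  by (rule clinearI; simp add: clinear_add clinear_scale algebra_simps cscale_times)+

lemma monomial_induct [case_names zero add]: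
  fixes m :: "'a \<Rightarrow>\<^sub>0 nat"
  assumes "Poly_Mapping.keys m \<subseteq> X"
    and zero: "P 0"
    and add: "\<And>x m. x \<in> X \<Longrightarrow> Poly_Mapping.keys m \<subseteq> X \<Longrightarrow> P m \<Longrightarrow> P (Poly_Mapping.single x 1 + m)"
  shows "P m"
  using assms(1)
proof (induction m rule: update_induct)
  case (update m a b)
  have *: "Poly_Mapping.update a b m = Poly_Mapping.single a b + m"
    using update.hyps(1)
    by (intro poly_mapping_eqI) (auto simp: lookup_update lookup_add lookup_single in_keys_iff when_def)
  have "a \<in> X" "Poly_Mapping.keys m \<subseteq> X"
    using update.prems update.hyps(2) by (auto simp: * keys_monomial_add)
  then have "P (Poly_Mapping.single a k + m)" for k
  proof (induction k)
    case 0
    then show ?case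
      using update.IH by simp
  next
    case (Suc k)
    then have "P (Poly_Mapping.single a 1 + (Poly_Mapping.single a k + m))"
      by (intro add) (auto simp: keys_monomial_add)
    then show ?case
      by (simp add: single_add[symmetric] flip: add.assoc)
  qed
  then show ?case
    by (simp add: *)
qed (rule zero)

definition subst_monom :: "('a \<Rightarrow> 'b) \<Rightarrow> ('a \<Rightarrow>\<^sub>0 nat) \<Rightarrow> ('b \<Rightarrow>\<^sub>0 nat)" where
  "subst_monom p m = (\<Sum>x\<in>Poly_Mapping.keys m. Poly_Mapping.single (p x) (Poly_Mapping.lookup m x))"

lemma subst_monom_superset:
  assumes "finite A" "Poly_Mapping.keys m \<subseteq> A"
  shows "subst_monom p m = (\<Sum>x\<in>A. Poly_Mapping.single (p x) (Poly_Mapping.lookup m x))"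
  unfolding subst_monom_def using assms by (intro sum.mono_neutral_left) (auto simp: in_keys_iff)

lemma subst_monom_zero [simp]: "subst_monom p 0 = 0"
  by (simp add: subst_monom_def)

lemma subst_monom_single [simp]: "subst_monom p (Poly_Mapping.single x n) = Poly_Mapping.single (p x) n"
  by (cases "n = 0") (simp_all add: subst_monom_def)

lemma subst_monom_add [simp]: "subst_monom p (m + n) = subst_monom p m + subst_monom p n"
  using subst_monom_superset[of "Poly_Mapping.keys m \<union> Poly_Mapping.keys n" _ p]
  by (simp add: keys_monomial_add lookup_add single_add sum.distrib)

lemma subst_monom_cong:
  "(\<And>x. x \<in> Poly_Mapping.keys m \<Longrightarrow> p x = q x) \<Longrightarrow> subst_monom p m = subst_monom q m"
  by (simp add: subst_monom_def)

lemma subst_monom_comp: "subst_monom p (subst_monom q m) = subst_monom (\<lambda>x. p (q x)) m"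
  by (rule monomial_induct[of m UNIV]) simp_all

lemma subst_monom_id:
  assumes "\<And>x. x \<in> Poly_Mapping.keys m \<Longrightarrow> p x = x"
  shows "subst_monom p m = m"
  using assms by (simp add: subst_monom_def sum_singles)

lemma keys_subst_monom: "Poly_Mapping.keys (subst_monom p m) = p ` Poly_Mapping.keys m"
  by (rule monomial_induct[of m UNIV]) (simp_all add: keys_monomial_add)

definition subst_poly :: "('a \<Rightarrow> 'b) \<Rightarrow> 'a cpoly \<Rightarrow> 'b cpoly" where
  "subst_poly p = lin_ext (\<lambda>m. Poly_Mapping.single (subst_monom p m) 1)"

lemma clinear_subst_poly: "clinear (subst_poly p)"
  unfolding subst_poly_def by (rule clinear_lin_ext)

lemma subst_poly_single [simp]:
  "subst_poly p (Poly_Mapping.single m c) = Poly_Mapping.single (subst_monom p m) c"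
  by (simp add: subst_poly_def)

lemma subst_poly_one [simp]: "subst_poly p 1 = 1"
  by (simp flip: single_one)

text \<open>Both sides are bilinear, and on monomials the claim is additivity of \<^const>\<open>subst_monom\<close>.\<close>
lemma subst_poly_mult: "subst_poly p (f * g) = subst_poly p f * subst_poly p g"
proof (rule clinear_eqI[of "\<lambda>f. subst_poly p (f * g)" "\<lambda>f. subst_poly p f * subst_poly p g"])
  fix m
  show "subst_poly p (Poly_Mapping.single m 1 * g) = subst_poly p (Poly_Mapping.single m 1) * subst_poly p g"
    by (rule clinear_eqI[of "\<lambda>g. subst_poly p (Poly_Mapping.single m 1 * g)"])
      (simp_all add: mult_single clinear_times_left clinear_subst_poly clinear_compose[OF clinear_subst_poly] clinear_ident)
qed (simp_all add: clinear_times_right clinear_subst_poly clinear_compose[OF clinear_subst_poly] clinear_ident)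

lemma clinear_sym_incl: "clinear sym_incl"
  unfolding sym_incl_def by (rule clinear_lin_ext)

lemma sym_incl_single: "sym_incl (Poly_Mapping.single x c) = Poly_Mapping.single (Poly_Mapping.single x 1) c"
  by (simp add: sym_incl_def)

lemma subst_poly_sym_incl:
  "subst_poly p (sym_incl v) = sym_incl (lin_ext (\<lambda>x. Poly_Mapping.single (p x) 1) v)"
  by (rule clinear_eqI[of "\<lambda>v. subst_poly p (sym_incl v)"])
    (simp_all add: clinear_compose[OF clinear_subst_poly clinear_sym_incl]
      clinear_compose[OF clinear_sym_incl clinear_lin_ext] sym_incl_single)

lemma keys_sym_incl: "Poly_Mapping.keys (sym_incl v) \<subseteq> (\<lambda>x. Poly_Mapping.single x 1) ` Poly_Mapping.keys v"
proof -
  have "Poly_Mapping.keys (sym_incl v)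
      \<subseteq> (\<Union>x\<in>Poly_Mapping.keys v. Poly_Mapping.keys
          (Poly_Mapping.single (Poly_Mapping.single x (1::nat)) (Poly_Mapping.lookup v x)))"
    unfolding sym_incl_def lin_ext_def by (rule order_trans[OF keys_sum]) simp
  then show ?thesis
    by (auto split: if_splits)
qed

lemma subspace_keys: "cspace.subspace {v. Poly_Mapping.keys v \<subseteq> A}"
proof (rule cspace.subspaceI)
  show "v + w \<in> {v. Poly_Mapping.keys v \<subseteq> A}"
    if "v \<in> {v. Poly_Mapping.keys v \<subseteq> A}" "w \<in> {v. Poly_Mapping.keys v \<subseteq> A}" for v w
    using that keys_add[of v w] by auto
  show "cscale c v \<in> {v. Poly_Mapping.keys v \<subseteq> A}" if "v \<in> {v. Poly_Mapping.keys v \<subseteq> A}" for c v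
    using that keys_cscale_subset[of c v] by auto
qed simp

lemma sym_alg_simps [simp]:
  "mult (sym_alg X) = (*)" "one (sym_alg X) = 1" "zero (sym_alg X) = 0" "add (sym_alg X) = (+)"
  "module.smult (sym_alg X) = cscale"
  by (simp_all add: sym_alg_def)

lemma carrier_sym_alg: "f \<in> carrier (sym_alg X) \<longleftrightarrow> (\<forall>m\<in>Poly_Mapping.keys f. Poly_Mapping.keys m \<subseteq> X)"
  by (simp add: sym_alg_def)

lemma subspace_carrier_sym_alg: "cspace.subspace (carrier (sym_alg X))"
proof -
  have "carrier (sym_alg X) = {f. Poly_Mapping.keys f \<subseteq> {m. Poly_Mapping.keys m \<subseteq> X}}"
    by (auto simp: sym_alg_def subset_iff)
  then show ?thesis
    by (simp only: subspace_keys)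
qed

lemma mult_in_sym_alg:
  assumes "f \<in> carrier (sym_alg X)" "g \<in> carrier (sym_alg X)"
  shows "f * g \<in> carrier (sym_alg X)"
  unfolding carrier_sym_alg
proof
  fix m
  assume "m \<in> Poly_Mapping.keys (f * g)"
  then obtain a b where "m = a + b" "a \<in> Poly_Mapping.keys f" "b \<in> Poly_Mapping.keys g"
    using keys_mult[of f g] by auto
  then show "Poly_Mapping.keys m \<subseteq> X"
    using assms by (simp add: carrier_sym_alg keys_monomial_add)
qed

lemma abelian_monoid_sym_alg: "abelian_monoid (sym_alg X)"
  by (rule abelian_monoidI)
    (simp_all add: subspace_carrier_sym_alg cspace.subspace_0 cspace.subspace_add algebra_simps)

lemma finsum_sym_alg:
  assumes "\<And>a. a \<in> A \<Longrightarrow> F a \<in> carrier (sym_alg X)"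
  shows "finsum (sym_alg X) F A = sum F A"
proof -
  interpret abelian_monoid "sym_alg X"
    by (rule abelian_monoid_sym_alg)
  show ?thesis
    using assms
  proof (induction A rule: infinite_finite_induct)
    case (insert a A)
    then show ?case
      by (subst finsum_insert) auto
  qed (simp_all add: finsum_infinite)
qed

section \<open>The grading of the symmetric algebra\<close>
lemma mult_degree_group [simp]:
  "(\<chi>, g) \<otimes>\<^bsub>degree_group X r\<^esub> (\<chi>', g') = ((\<lambda>h\<in>carrier (calH X r). \<chi> h * \<chi>' h), g \<otimes>\<^bsub>calH X r\<^esub> g')"
  by (simp add: degree_group_def char_group_def DirProd_def)

lemma one_degree_group [simp]: "\<one>\<^bsub>degree_group X r\<^esub> = ((\<lambda>h\<in>carrier (calH X r). 1), \<one>\<^bsub>calH X r\<^esub>)"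
  by (simp add: degree_group_def char_group_def DirProd_def)

lemma carrier_degree_group:
  "(\<chi>, g) \<in> carrier (degree_group X r) \<longleftrightarrow> \<chi> \<in> carrier (char_group (calH X r)) \<and> g \<in> carrier (calH X r)"
  by (simp add: degree_group_def DirProd_def)

lemma one_in_char_group:
  assumes "group G"
  shows "(\<lambda>h\<in>carrier G. 1) \<in> carrier (char_group G)"
  using assms by (auto simp: char_group_def hom_def complex_units_def group.is_monoid monoid.m_closed)

lemma mult_in_char_group:
  assumes "group G" "\<chi> \<in> carrier (char_group G)" "\<psi> \<in> carrier (char_group G)"
  shows "(\<lambda>h\<in>carrier G. \<chi> h * \<psi> h) \<in> carrier (char_group G)"
  using assms by (auto simp: char_group_def hom_def complex_units_def group.is_monoid monoid.m_closed Pi_iff)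

context level2_solution
begin

text \<open>The group part of the degree of a monomial. The product runs over all of \<open>X\<close> and not only over the
  variables that occur, so that additivity is immediate.\<close>
definition monom_degree :: "('a \<Rightarrow>\<^sub>0 nat) \<Rightarrow> 'a calH_elt" where
  "monom_degree m = finprod (calH X r) (\<lambda>x. gam X r (orb_of X r x) [^]\<^bsub>calH X r\<^esub> Poly_Mapping.lookup m x) X"

lemma monom_degree_in [simp, intro]: "monom_degree m \<in> carrier (calH X r)"
  unfolding monom_degree_def by (intro H.finprod_closed) auto

lemma monom_degree_zero [simp]: "monom_degree 0 = \<one>\<^bsub>calH X r\<^esub>"
  by (simp add: monom_degree_def H.finprod_one)

lemma monom_degree_add: "monom_degree (m + n) = monom_degree m \<otimes>\<^bsub>calH X r\<^esub> monom_degree n"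
proof -
  have "monom_degree (m + n) = finprod (calH X r) (\<lambda>x. gam X r (orb_of X r x) [^]\<^bsub>calH X r\<^esub> Poly_Mapping.lookup m x
      \<otimes>\<^bsub>calH X r\<^esub> gam X r (orb_of X r x) [^]\<^bsub>calH X r\<^esub> Poly_Mapping.lookup n x) X"
    unfolding monom_degree_def
    by (intro H.finprod_cong') (auto simp: lookup_add H.nat_pow_mult intro!: H.m_closed)
  also have "\<dots> = monom_degree m \<otimes>\<^bsub>calH X r\<^esub> monom_degree n"
    unfolding monom_degree_def by (rule H.finprod_multf) auto
  finally show ?thesis .
qed

lemma monom_degree_single:
  assumes "x \<in> X"
  shows "monom_degree (Poly_Mapping.single x 1) = gam X r (orb_of X r x)"
proof -
  have "monom_degree (Poly_Mapping.single x 1)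
      = finprod (calH X r) (\<lambda>y. if x = y then gam X r (orb_of X r y) else \<one>\<^bsub>calH X r\<^esub>) X"
    unfolding monom_degree_def using assms
    by (intro H.finprod_cong') (auto simp: lookup_single when_def)
  also have "\<dots> = gam X r (orb_of X r x)"
    using assms finite_X by (intro H.finprod_singleton) auto
  finally show ?thesis .
qed

text \<open>The degree \<open>\<gamma>\<close> of a variable depends only on its orbit.\<close>
lemma monom_degree_subst:
  assumes "Poly_Mapping.keys m \<subseteq> X"
    and p: "\<And>x. x \<in> X \<Longrightarrow> p x \<in> X \<and> orb_of X r (p x) = orb_of X r x"
  shows "monom_degree (subst_monom p m) = monom_degree m"
  using assms(1)
  by (induction m rule: monomial_induct[consumes 1]) (simp_all add: monom_degree_add monom_degree_single[simplified] p)

definition act_poly :: "'a calH_elt \<Rightarrow> 'a cpoly \<Rightarrow> 'a cpoly" where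
  "act_poly h = subst_poly (act h)"

lemma clinear_act_poly: "clinear (act_poly h)"
  unfolding act_poly_def by (rule clinear_subst_poly)

lemma calH_act_eq: "calH_act X r h = lin_ext (\<lambda>x. Poly_Mapping.single (act h x) 1)"
  by (simp add: calH_act_def act_def)

lemma act_poly_sym_incl: "act_poly h (sym_incl v) = sym_incl (calH_act X r h v)"
  by (simp add: act_poly_def calH_act_eq subst_poly_sym_incl)

text \<open>The intrinsic form of the homogeneous components: eigenvectors of the whole group that involve
  only monomials of the prescribed group degree. It contains the component spanned by products of
  homogeneous vectors, and it is visibly a joint eigenspace, which gives independence.\<close>
definition component :: "'a degree \<Rightarrow> 'a cpoly set" where
  "component d = {f \<in> carrier (sym_alg X). (\<forall>m\<in>Poly_Mapping.keys f. monom_degree m = snd d) \<and>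
     (\<forall>h\<in>carrier (calH X r). act_poly h f = cscale (fst d h) f)}"

lemma subspace_component: "cspace.subspace (component d)"
proof -
  have "component d = carrier (sym_alg X) \<inter> {f. Poly_Mapping.keys f \<subseteq> {m. monom_degree m = snd d}} \<inter>
      {f. \<forall>h\<in>carrier (calH X r). act_poly h f = cscale (fst d h) f}"
    by (auto simp: component_def)
  moreover have "cspace.subspace {f. \<forall>h\<in>carrier (calH X r). act_poly h f = cscale (fst d h) f}"
    by (rule cspace.subspaceI)
      (auto simp: clinear_0[OF clinear_act_poly] clinear_add[OF clinear_act_poly]
        clinear_scale[OF clinear_act_poly] cspace.scale_right_distrib mult.commute)
  ultimately show ?thesis
    by (simp add: cspace.subspace_inter subspace_carrier_sym_alg subspace_keys)
qed

lemma vec_homog_degree: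
  assumes "vec_homog X r v d"
  shows "d \<in> carrier (degree_group X r)" and "sym_incl v \<in> component d"
proof -
  obtain i \<chi> where i: "i \<in> orbs X r" and \<chi>: "\<chi> \<in> carrier (char_group (calH X r))"
    and d: "d = (\<chi>, gam X r i)" and keys: "Poly_Mapping.keys v \<subseteq> i"
    and ev: "\<And>h. h \<in> carrier (calH X r) \<Longrightarrow> calH_act X r h v = cscale (\<chi> h) v"
    using assms unfolding vec_homog_def by auto
  show "d \<in> carrier (degree_group X r)"
    using i \<chi> by (auto simp: d carrier_degree_group elim!: orbsE)
  have "Poly_Mapping.keys m \<subseteq> X \<and> monom_degree m = gam X r i" if m_in: "m \<in> Poly_Mapping.keys (sym_incl v)" for m
  proof -
    obtain x where m: "m = Poly_Mapping.single x 1" and "x \<in> Poly_Mapping.keys v"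
      using subsetD[OF keys_sym_incl m_in] by auto
    then have "x \<in> i"
      using keys by auto
    then have "x \<in> X" "orb_of X r x = i"
      using orbs_subset[OF i] orb_of_member[OF i] by auto
    then show ?thesis
      using monom_degree_single m by simp
  qed
  then show "sym_incl v \<in> component d"
    by (simp add: component_def carrier_sym_alg d act_poly_sym_incl ev clinear_scale[OF clinear_sym_incl])
qed

lemma component_mult:
  assumes "f \<in> component d" "g \<in> component e"
  shows "f * g \<in> component (d \<otimes>\<^bsub>degree_group X r\<^esub> e)"
proof -
  obtain \<chi> g1 \<psi> g2 where de: "d = (\<chi>, g1)" "e = (\<psi>, g2)"
    by fastforce
  have "monom_degree m = g1 \<otimes>\<^bsub>calH X r\<^esub> g2" if m_in: "m \<in> Poly_Mapping.keys (f * g)" for m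
  proof -
    obtain a b where "m = a + b" "a \<in> Poly_Mapping.keys f" "b \<in> Poly_Mapping.keys g"
      using subsetD[OF keys_mult m_in] by auto
    then show ?thesis
      using assms by (simp add: component_def de monom_degree_add)
  qed
  then show ?thesis
    using assms by (auto simp: component_def de mult_in_sym_alg act_poly_def subst_poly_mult cscale_times)
qed

lemma one_in_component: "1 \<in> component \<one>\<^bsub>degree_group X r\<^esub>"
  by (simp add: component_def carrier_sym_alg act_poly_def)

lemma prod_homog_degree:
  assumes "prod_homog X r f d"
  shows "d \<in> carrier (degree_group X r) \<and> f \<in> component d"
  using assms
proof (induction rule: prod_homog.induct)
  case one
  then show ?case
    using one_in_component
    by (simp add: carrier_degree_group one_in_char_group H.is_group)
next
  case (mult v d f e)
  have "d \<otimes>\<^bsub>degree_group X r\<^esub> e \<in> carrier (degree_group X r)"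
    using vec_homog_degree(1)[OF mult.hyps(1)] mult.IH
    by (cases d; cases e) (simp add: carrier_degree_group mult_in_char_group H.is_group)
  then show ?case
    using component_mult vec_homog_degree(2) mult by blast
qed

lemma sym_grading_subset: "sym_grading X r d \<subseteq> component d"
  unfolding sym_grading_def
  by (rule cspace.span_minimal[OF _ subspace_component]) (use prod_homog_degree in blast)

lemma subspace_sym_grading: "cspace.subspace (sym_grading X r d)"
  unfolding sym_grading_def by (rule cspace.subspace_span)

lemma sym_grading_in_sym_alg: "f \<in> sym_grading X r d \<Longrightarrow> f \<in> carrier (sym_alg X)"
  by (drule subsetD[OF sym_grading_subset]) (simp add: component_def)

text \<open>Operators that tell the degrees apart: the group elements detect the character, and the
  projections to the monomials of a fixed group degree detect the group part.\<close>
fun separating_op :: "'a calH_elt + 'a calH_elt \<Rightarrow> 'a cpoly \<Rightarrow> 'a cpoly" where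
  "separating_op (Inl h) f = (if h \<in> carrier (calH X r) then act_poly h f else 0)"
| "separating_op (Inr g) f = lin_ext (\<lambda>m. if monom_degree m = g then Poly_Mapping.single m 1 else 0) f"

fun separating_eigenvalue :: "'a degree \<Rightarrow> 'a calH_elt + 'a calH_elt \<Rightarrow> complex" where
  "separating_eigenvalue d (Inl h) = (if h \<in> carrier (calH X r) then fst d h else 0)"
| "separating_eigenvalue d (Inr g) = (if snd d = g then 1 else 0)"

lemma clinear_separating_op: "clinear (separating_op s)"
proof (cases s)
  case (Inl h)
  then show ?thesis
    by (intro clinearI) (simp_all add: clinear_add[OF clinear_act_poly] clinear_scale[OF clinear_act_poly])
next
  case (Inr g)
  then show ?thesis
    by (intro clinearI) (simp_all add: clinear_add[OF clinear_lin_ext] clinear_scale[OF clinear_lin_ext])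
qed

lemma separating_op_component:
  assumes "f \<in> component d"
  shows "separating_op s f = cscale (separating_eigenvalue d s) f"
proof (cases s)
  case (Inl h)
  then show ?thesis
    using assms by (simp add: component_def)
next
  case (Inr g)
  have "lin_ext (\<lambda>m. if monom_degree m = g then Poly_Mapping.single m 1 else 0) f
      = lin_ext (\<lambda>m. cscale (if snd d = g then 1 else 0) (Poly_Mapping.single m 1)) f"
    using assms by (auto simp: lin_ext_def component_def intro!: sum.cong)
  also have "\<dots> = cscale (if snd d = g then 1 else 0) f"
    by (rule clinear_expansion[symmetric, OF clinear_cscale[OF clinear_ident]])
  finally show ?thesis
    using Inr by simp
qed

lemma inj_on_separating_eigenvalue: "inj_on separating_eigenvalue (carrier (degree_group X r))"
proof (rule inj_onI)
  fix d e
  assume de: "d \<in> carrier (degree_group X r)" "e \<in> carrier (degree_group X r)" and eq: "separating_eigenvalue d = separating_eigenvalue e"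
  have "snd d = snd e"
    using fun_cong[OF eq, of "Inr (snd d)"] by (simp split: if_splits)
  moreover have "fst d = fst e"
  proof (rule extensionalityI)
    show "fst d \<in> extensional (carrier (calH X r))" "fst e \<in> extensional (carrier (calH X r))"
      using de by (auto simp: degree_group_def DirProd_def char_group_def)
    show "fst d h = fst e h" if "h \<in> carrier (calH X r)" for h
      using fun_cong[OF eq, of "Inl h"] that by simp
  qed
  ultimately show "d = e"
    by (simp add: prod_eq_iff)
qed

lemma components_independent:
  assumes "finite D" "D \<subseteq> carrier (degree_group X r)" "\<And>d. d \<in> D \<Longrightarrow> e d \<in> component d"
    and "(\<Sum>d\<in>D. e d) = 0" "d \<in> D"
  shows "e d = 0"
  using assms separating_op_component clinear_separating_op inj_on_subset[OF inj_on_separating_eigenvalue]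
  by (intro separated_eigenvectors_independent[of D separating_op e separating_eigenvalue]) auto

definition homog_vectors :: "('a \<Rightarrow>\<^sub>0 complex) set" where
  "homog_vectors = {v. \<exists>d. vec_homog X r v d}"

lemma calH_act_compose:
  assumes "g \<in> carrier (calH X r)" "h \<in> carrier (calH X r)" "Poly_Mapping.keys v \<subseteq> X"
  shows "calH_act X r (g \<otimes>\<^bsub>calH X r\<^esub> h) v = calH_act X r g (calH_act X r h v)"
  unfolding calH_act_eq
  by (rule clinear_eqI[OF clinear_lin_ext clinear_compose[OF clinear_lin_ext clinear_lin_ext]])
    (use assms in \<open>auto simp: act_mult\<close>)

lemma calH_act_one:
  assumes "Poly_Mapping.keys v \<subseteq> X"
  shows "calH_act X r \<one>\<^bsub>calH X r\<^esub> v = v"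
  unfolding calH_act_eq
  by (rule clinear_eqI[OF clinear_lin_ext clinear_ident]) (use assms in auto)

lemma keys_calH_act:
  assumes "h \<in> carrier (calH X r)" "i \<in> orbs X r" "Poly_Mapping.keys v \<subseteq> i"
  shows "Poly_Mapping.keys (calH_act X r h v) \<subseteq> i"
proof -
  have "act h x \<in> i" if "x \<in> Poly_Mapping.keys v" for x
    using that assms act_in_orb[of h x] orb_of_member[of i x] orbs_subset[of i] by auto
  then have "(\<Sum>x\<in>Poly_Mapping.keys v. cscale (Poly_Mapping.lookup v x) (Poly_Mapping.single (act h x) 1))
      \<in> {v. Poly_Mapping.keys v \<subseteq> i}"
    by (intro cspace.subspace_sum subspace_keys) (auto split: if_splits)
  then show ?thesis
    by (simp add: calH_act_eq lin_ext_def)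
qed

text \<open>The eigenvalues of a nonzero joint eigenvector depend multiplicatively on the group element, so
  they are the values of a character.\<close>
lemma joint_eigenvector_homogeneous:
  assumes i: "i \<in> orbs X r" and w: "Poly_Mapping.keys w \<subseteq> i" "w \<noteq> 0"
    and ev: "\<forall>h\<in>carrier (calH X r). \<exists>c. calH_act X r h w = cscale c w"
  shows "w \<in> homog_vectors"
proof -
  obtain c where c: "\<And>h. h \<in> carrier (calH X r) \<Longrightarrow> calH_act X r h w = cscale (c h) w"
    using ev by metis
  have wX: "Poly_Mapping.keys w \<subseteq> X"
    using w orbs_subset[OF i] by auto
  have lin: "clinear (calH_act X r h)" for h
    by (simp add: calH_act_eq clinear_lin_ext)
  have mult: "c (g \<otimes>\<^bsub>calH X r\<^esub> h) = c g * c h"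
    if "g \<in> carrier (calH X r)" "h \<in> carrier (calH X r)" for g h
  proof -
    have "cscale (c (g \<otimes>\<^bsub>calH X r\<^esub> h)) w = cscale (c g * c h) w"
      using calH_act_compose[OF that wX] that
      by (simp add: c[symmetric] clinear_scale[OF lin] mult.commute) (simp add: c clinear_scale[OF lin] mult.commute)
    then show ?thesis
      using w(2) by (simp only: cspace.scale_cancel_right) simp
  qed
  have one: "c \<one>\<^bsub>calH X r\<^esub> = 1"
    using calH_act_one[OF wX] c[of "\<one>\<^bsub>calH X r\<^esub>"] w(2)
      cspace.scale_cancel_right[of "c \<one>\<^bsub>calH X r\<^esub>" w 1] by simp
  have nz: "c h \<noteq> 0" if "h \<in> carrier (calH X r)" for h
    using mult[of h "inv\<^bsub>calH X r\<^esub> h"] one that by auto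
  let ?\<chi> = "restrict c (carrier (calH X r))"
  have "?\<chi> \<in> carrier (char_group (calH X r))"
    using mult nz by (auto simp: char_group_def hom_def complex_units_def)
  then have "vec_homog X r w (?\<chi>, gam X r i)"
    unfolding vec_homog_def using i w(1) c by (intro bexI[of _ i] bexI[of _ ?\<chi>]) auto
  then show ?thesis
    by (auto simp: homog_vectors_def)
qed

text \<open>On the span of one orbit the group acts by commuting operators whose order divides the order of
  the group.\<close>
lemma variable_in_span:
  assumes "x \<in> X"
  shows "Poly_Mapping.single x 1 \<in> cspace.span homog_vectors"
proof -
  let ?i = "orb_of X r x" and ?T = "calH_act X r"
  let ?W = "{v :: 'a \<Rightarrow>\<^sub>0 complex. Poly_Mapping.keys v \<subseteq> ?i}"
  have i: "?i \<in> orbs X r"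
    using assms by simp
  have WX: "Poly_Mapping.keys v \<subseteq> X" if "v \<in> ?W" for v :: "'a \<Rightarrow>\<^sub>0 complex"
    using that orbs_subset[OF i] by auto
  have pow: "(?T h ^^ n) v = ?T (h [^]\<^bsub>calH X r\<^esub> n) v" if "h \<in> carrier (calH X r)" "v \<in> ?W" for h v and n :: nat
  proof (induction n)
    case 0
    then show ?case
      using calH_act_one[OF WX[OF that(2)]] by simp
  next
    case (Suc n)
    have "?T (h [^]\<^bsub>calH X r\<^esub> Suc n) v = ?T (h \<otimes>\<^bsub>calH X r\<^esub> h [^]\<^bsub>calH X r\<^esub> n) v"
      using that(1) by (simp add: H.m_comm)
    then show ?case
      using Suc calH_act_compose[OF that(1) _ WX[OF that(2)]] that(1) by simp
  qed
  have "Poly_Mapping.single x 1 \<in>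
      cspace.span {w \<in> ?W. \<forall>h\<in>carrier (calH X r). \<exists>c. ?T h w = cscale c w}"
  proof (rule joint_eigen_decomposition[OF finite_calH subspace_keys])
    show "clinear (?T h)" for h
      by (simp add: calH_act_eq clinear_lin_ext)
    show "?T h w \<in> ?W" if "h \<in> carrier (calH X r)" "w \<in> ?W" for h w
      using keys_calH_act[OF that(1) i] that(2) by simp
    show "?T g (?T h w) = ?T h (?T g w)"
      if "g \<in> carrier (calH X r)" "h \<in> carrier (calH X r)" "w \<in> ?W" for g h w
      using that calH_act_compose[OF _ _ WX[OF that(3)]] H.m_comm by metis
    show "\<exists>n>0. (?T h ^^ n) w = w" if "h \<in> carrier (calH X r)" "w \<in> ?W" for h w
      using pow[OF that, of "order (calH X r)"] H.pow_order_eq_1[OF that(1)]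
        calH_act_one[OF WX[OF that(2)]] H.order_gt_0_iff_finite finite_calH by auto
    show "Poly_Mapping.single x 1 \<in> ?W"
      using assms by simp
  qed
  also have "\<dots> \<subseteq> cspace.span homog_vectors"
  proof (rule cspace.span_minimal)
    show "{w \<in> ?W. \<forall>h\<in>carrier (calH X r). \<exists>c. ?T h w = cscale c w} \<subseteq> cspace.span homog_vectors"
      using joint_eigenvector_homogeneous[OF i] cspace.span_base cspace.span_zero by blast
  qed (rule cspace.subspace_span)
  finally show ?thesis .
qed

text \<open>A monomial is a product of variables, and each variable is a combination of homogeneous
  vectors.\<close>
lemma sym_alg_spanned:
  assumes "f \<in> carrier (sym_alg X)"
  shows "f \<in> cspace.span {f. \<exists>d. prod_homog X r f d}"
proof -
  let ?P = "cspace.span {f. \<exists>d. prod_homog X r f d}"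
  have step: "sym_incl v * g \<in> ?P" if "v \<in> cspace.span homog_vectors" "g \<in> ?P" for v g
  proof (rule clinear_span_into[OF _ cspace.subspace_span _ that(1), of "\<lambda>v. sym_incl v * g"])
    show "clinear (\<lambda>v. sym_incl v * g)"
      by (rule clinear_times_right[OF clinear_sym_incl])
    fix b
    assume b: "b \<in> homog_vectors"
    show "sym_incl b * g \<in> ?P"
    proof (rule clinear_span_into[OF clinear_times_left[OF clinear_ident] cspace.subspace_span _ that(2)])
      show "sym_incl b * f \<in> ?P" if f: "f \<in> {f. \<exists>d. prod_homog X r f d}" for f
      proof -
        obtain d e where "vec_homog X r b d" "prod_homog X r f e"
          using f b unfolding homog_vectors_def by blast
        then show ?thesis
          using prod_homog.mult by (blast intro: cspace.span_base)
      qed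
    qed
  qed
  have "Poly_Mapping.single m 1 \<in> ?P" if "Poly_Mapping.keys m \<subseteq> X" for m
    using that
  proof (induction m rule: monomial_induct[consumes 1])
    case zero
    then show ?case
      using prod_homog.one by (auto intro!: cspace.span_base)
  next
    case (add x m)
    then show ?case
      using step[OF variable_in_span[OF add(1)] add(3)] by (simp add: sym_incl_single mult_single)
  qed
  then have "(\<Sum>m\<in>Poly_Mapping.keys f. cscale (Poly_Mapping.lookup f m) (Poly_Mapping.single m 1)) \<in> ?P"
    using assms by (intro cspace.span_sum cspace.span_scale) (auto simp: carrier_sym_alg)
  then show ?thesis
    by (simp add: sum_singles)
qed

lemma homogeneous_decomposition:
  assumes "f \<in> carrier (sym_alg X)"
  obtains c D where "finite D" "D \<subseteq> carrier (degree_group X r)" "\<And>d. c d \<in> sym_grading X r d"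
    "\<And>d. d \<notin> D \<Longrightarrow> c d = 0" "f = (\<Sum>d\<in>D. c d)"
proof -
  let ?dec = "\<lambda>f c D. finite D \<and> D \<subseteq> carrier (degree_group X r) \<and> (\<forall>d. c d \<in> sym_grading X r d) \<and>
    (\<forall>d. d \<notin> D \<longrightarrow> c d = 0) \<and> f = (\<Sum>d\<in>D. c d)"
  have "cspace.subspace {f. \<exists>c D. ?dec f c D}"
  proof (rule cspace.subspaceI)
    show "0 \<in> {f. \<exists>c D. ?dec f c D}"
      by (auto intro!: exI[of _ "\<lambda>_. 0"] exI[of _ "{}"] cspace.subspace_0 subspace_sym_grading)
  next
    fix f g
    assume "f \<in> {f. \<exists>c D. ?dec f c D}" "g \<in> {f. \<exists>c D. ?dec f c D}"
    then obtain c D c' D' where D: "?dec f c D" and D': "?dec g c' D'"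
      by (elim CollectE exE)
    have "f = (\<Sum>d\<in>D \<union> D'. c d)" "g = (\<Sum>d\<in>D \<union> D'. c' d)"
      using D D' by (auto intro!: sum.mono_neutral_left)
    then have "f + g = (\<Sum>d\<in>D \<union> D'. c d + c' d)"
      by (simp add: sum.distrib)
    then have "?dec (f + g) (\<lambda>d. c d + c' d) (D \<union> D')"
      using D D' by (auto intro: cspace.subspace_add subspace_sym_grading)
    then show "f + g \<in> {f. \<exists>c D. ?dec f c D}"
      by (intro CollectI exI)
  next
    fix a f
    assume "f \<in> {f. \<exists>c D. ?dec f c D}"
    then obtain c D where "?dec f c D"
      by (elim CollectE exE)
    then have "?dec (cscale a f) (\<lambda>d. cscale a (c d)) D"
      by (auto simp: cspace.scale_sum_right intro: cspace.subspace_scale subspace_sym_grading)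
    then show "cscale a f \<in> {f. \<exists>c D. ?dec f c D}"
      by (intro CollectI exI)
  qed
  moreover have "{f. \<exists>d. prod_homog X r f d} \<subseteq> {f. \<exists>c D. ?dec f c D}"
  proof clarify
    fix f d
    assume f: "prod_homog X r f d"
    then have "f \<in> sym_grading X r d"
      by (auto simp: sym_grading_def intro: cspace.span_base)
    then have "?dec f (\<lambda>e. if e = d then f else 0) {d}"
      using prod_homog_degree[OF f] by (auto intro: cspace.subspace_0 subspace_sym_grading)
    then show "\<exists>c D. ?dec f c D"
      by (intro exI)
  qed
  ultimately have "cspace.span {f. \<exists>d. prod_homog X r f d} \<subseteq> {f. \<exists>c D. ?dec f c D}"
    by (intro cspace.span_minimal)
  then have "f \<in> {f. \<exists>c D. ?dec f c D}"
    using sym_alg_spanned[OF assms] by (rule subsetD)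
  then obtain c D where "?dec f c D"
    by (elim CollectE exE)
  then show thesis
    using that[of D c] by meson
qed

abbreviation parts :: "'a cpoly \<Rightarrow> 'a degree \<Rightarrow> 'a cpoly" where
  "parts \<equiv> hom_parts (sym_alg X) (degree_group X r) (sym_grading X r)"

abbreviation supp :: "'a cpoly \<Rightarrow> 'a degree set" where
  "supp \<equiv> hom_supp (sym_alg X) (degree_group X r) (sym_grading X r)"

text \<open>Existence and uniqueness of the decomposition into homogeneous parts justify the definite
  description in \<^const>\<open>hom_parts\<close>.\<close>
lemma hom_parts_decomposition:
  assumes "f \<in> carrier (sym_alg X)"
  shows "\<And>d. d \<in> carrier (degree_group X r) \<Longrightarrow> parts f d \<in> sym_grading X r d"
    and "finite (supp f)" and "f = (\<Sum>d\<in>supp f. parts f d)"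
proof -
  let ?H = "degree_group X r"
  define Dec where "Dec c \<longleftrightarrow> c \<in> (\<Pi>\<^sub>E d\<in>carrier ?H. sym_grading X r d) \<and>
    finite {d \<in> carrier ?H. c d \<noteq> 0} \<and> f = (\<Sum>d\<in>{d \<in> carrier ?H. c d \<noteq> 0}. c d)" for c
  have Dec_iff: "Dec c \<longleftrightarrow> c \<in> (\<Pi>\<^sub>E d\<in>carrier ?H. sym_grading X r d) \<and>
             finite {d \<in> carrier ?H. c d \<noteq> \<zero>\<^bsub>sym_alg X\<^esub>} \<and>
             f = (\<Oplus>\<^bsub>sym_alg X\<^esub>d\<in>{d \<in> carrier ?H. c d \<noteq> \<zero>\<^bsub>sym_alg X\<^esub>}. c d)" for c
  proof (cases "c \<in> (\<Pi>\<^sub>E d\<in>carrier ?H. sym_grading X r d)")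
    case True
    then have "finsum (sym_alg X) c {d \<in> carrier ?H. c d \<noteq> 0} = sum c {d \<in> carrier ?H. c d \<noteq> 0}"
      using sym_grading_in_sym_alg by (intro finsum_sym_alg) (auto simp: PiE_iff)
    then show ?thesis
      by (simp add: Dec_def)
  qed (simp add: Dec_def)
  have "\<exists>c. Dec c"
  proof -
    obtain c D where D: "finite D" "D \<subseteq> carrier ?H" "\<And>d. c d \<in> sym_grading X r d"
      "\<And>d. d \<notin> D \<Longrightarrow> c d = 0" "f = (\<Sum>d\<in>D. c d)"
      using homogeneous_decomposition[OF assms] by metis
    let ?c = "restrict c (carrier ?H)"
    have sub: "{d \<in> carrier ?H. ?c d \<noteq> 0} \<subseteq> D"
      using D(4) by auto
    have "(\<Sum>d\<in>D. c d) = (\<Sum>d\<in>{d \<in> carrier ?H. ?c d \<noteq> 0}. ?c d)"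
      using D(1,2) sub by (intro sum.mono_neutral_cong_right) auto
    then have "Dec ?c"
      using D finite_subset[OF sub D(1)] by (auto simp: Dec_def)
    then show ?thesis
      by (rule exI[of Dec])
  qed
  moreover have "c = c'" if c: "Dec c" and c': "Dec c'" for c c'
  proof (rule PiE_ext)
    show "c \<in> (\<Pi>\<^sub>E d\<in>carrier ?H. sym_grading X r d)" "c' \<in> (\<Pi>\<^sub>E d\<in>carrier ?H. sym_grading X r d)"
      using that by (simp_all add: Dec_def)
    fix d
    assume d: "d \<in> carrier ?H"
    let ?D = "{d \<in> carrier ?H. c d \<noteq> 0} \<union> {d \<in> carrier ?H. c' d \<noteq> 0}"
    have "finite {d \<in> carrier ?H. c d \<noteq> 0}" "finite {d \<in> carrier ?H. c' d \<noteq> 0}"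
      using c c' by (simp_all add: Dec_def)
    then have "(\<Sum>d\<in>{d \<in> carrier ?H. c d \<noteq> 0}. c d) = (\<Sum>d\<in>?D. c d)"
      "(\<Sum>d\<in>{d \<in> carrier ?H. c' d \<noteq> 0}. c' d) = (\<Sum>d\<in>?D. c' d)"
      by (auto intro!: sum.mono_neutral_left)
    then have "f = (\<Sum>d\<in>?D. c d)" "f = (\<Sum>d\<in>?D. c' d)"
      using c c' unfolding Dec_def by metis+
    then have "(\<Sum>d\<in>?D. c d - c' d) = 0"
      by (simp add: sum_subtractf)
    moreover have "c d - c' d \<in> component d" if "d \<in> ?D" for d
    proof -
      have "c d \<in> sym_grading X r d" "c' d \<in> sym_grading X r d"
        using c c' that by (auto simp: Dec_def PiE_iff)
      then show ?thesis
        by (intro cspace.subspace_diff subspace_component subsetD[OF sym_grading_subset])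
    qed
    ultimately have "c d - c' d = 0" if "d \<in> ?D"
      using components_independent[of ?D "\<lambda>d. c d - c' d" d] that c c' by (auto simp: Dec_def)
    then show "c d = c' d"
      using d by (cases "d \<in> ?D") simp_all
  qed
  ultimately have "\<exists>!c. Dec c"
    by blast
  moreover have "parts f = (THE c. Dec c)"
    unfolding hom_parts_def Dec_iff ..
  ultimately have *: "Dec (parts f)"
    using theI' by metis
  show "\<And>d. d \<in> carrier ?H \<Longrightarrow> parts f d \<in> sym_grading X r d"
    using * by (auto simp: Dec_def PiE_iff)
  show "finite (supp f)" "f = (\<Sum>d\<in>supp f. parts f d)"
    using * by (simp_all add: Dec_def hom_supp_def)
qed

section \<open>The cotwisted product without characters\<close>
definition twisted_mult :: "'a cpoly \<Rightarrow> 'a cpoly \<Rightarrow> 'a cpoly" where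
  "twisted_mult f g = lin_ext (\<lambda>m. Poly_Mapping.single m 1 * act_poly (monom_degree m) g) f"

lemma clinear_twisted_left: "clinear (\<lambda>f. twisted_mult f g)"
  unfolding twisted_mult_def by (rule clinear_lin_ext)

lemma clinear_twisted_right: "clinear (twisted_mult f)"
  unfolding twisted_mult_def
  by (rule clinear_lin_ext_coeff) (rule clinear_times_left[OF clinear_act_poly])

text \<open>All monomials of \<open>f\<close> have the group part of \<open>d\<close> as their degree, and its action multiplies \<open>g\<close> by the
  value of the character of \<open>e\<close>. This value is the cocycle.\<close>
lemma twisted_mult_components:
  assumes "f \<in> component d" "g \<in> component e" "d \<in> carrier (degree_group X r)"
  shows "twisted_mult f g = cscale (eval_cocycle d e) (f * g)"
proof -
  obtain \<chi> g1 \<psi> g2 where de: "d = (\<chi>, g1)" "e = (\<psi>, g2)"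
    by fastforce
  have "twisted_mult f g = lin_ext (\<lambda>m. Poly_Mapping.single m 1 * cscale (\<psi> g1) g) f"
    unfolding twisted_mult_def lin_ext_def
    using assms by (intro sum.cong refl) (auto simp: component_def de carrier_degree_group)
  also have "\<dots> = f * cscale (\<psi> g1) g"
    by (rule clinear_expansion[symmetric, OF clinear_times_right[OF clinear_ident]])
  finally show ?thesis
    by (simp add: de eval_cocycle_def cscale_times)
qed

text \<open>Both products are bilinear, and they agree on homogeneous elements.\<close>
lemma mult_cotwisted:
  assumes "f \<in> carrier (sym_alg X)" "g \<in> carrier (sym_alg X)"
  shows "mult (cotwisted_sym_alg X r) f g = twisted_mult f g"
proof -
  have supp: "supp f \<subseteq> carrier (degree_group X r)" for f
    by (auto simp: hom_supp_def)
  have parts: "parts f d \<in> component d" "parts f d \<in> carrier (sym_alg X)"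
    if "d \<in> supp f" "f \<in> carrier (sym_alg X)" for f d
  proof -
    have "parts f d \<in> sym_grading X r d"
      using hom_parts_decomposition(1)[OF that(2), of d] that(1) supp by blast
    then show "parts f d \<in> component d" "parts f d \<in> carrier (sym_alg X)"
      by (rule subsetD[OF sym_grading_subset], rule sym_grading_in_sym_alg)
  qed
  have closed: "cscale c (parts f a * parts g b) \<in> carrier (sym_alg X)"
    if "a \<in> supp f" "b \<in> supp g" for a b c
    using that assms parts
    by (intro cspace.subspace_scale[OF subspace_carrier_sym_alg] mult_in_sym_alg) auto
  have inner: "(\<Oplus>\<^bsub>sym_alg X\<^esub>b\<in>supp g. cscale (eval_cocycle a b) (parts f a * parts g b))
      = (\<Sum>b\<in>supp g. cscale (eval_cocycle a b) (parts f a * parts g b))" if "a \<in> supp f" for a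
    using that by (intro finsum_sym_alg closed)
  have "mult (cotwisted_sym_alg X r) f g = (\<Oplus>\<^bsub>sym_alg X\<^esub>a\<in>supp f. \<Oplus>\<^bsub>sym_alg X\<^esub>b\<in>supp g.
      cscale (eval_cocycle a b) (parts f a * parts g b))"
    by (simp add: cotwisted_sym_alg_def cotwist_def)
  also have "\<dots> = (\<Sum>a\<in>supp f. \<Oplus>\<^bsub>sym_alg X\<^esub>b\<in>supp g. cscale (eval_cocycle a b) (parts f a * parts g b))"
    by (rule finsum_sym_alg)
      (simp add: inner closed cspace.subspace_sum[OF subspace_carrier_sym_alg])
  also have "\<dots> = (\<Sum>a\<in>supp f. \<Sum>b\<in>supp g. twisted_mult (parts f a) (parts g b))"
  proof (intro sum.cong refl)
    fix a
    assume a: "a \<in> supp f"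
    have "twisted_mult (parts f a) (parts g b) = cscale (eval_cocycle a b) (parts f a * parts g b)"
      if "b \<in> supp g" for b
      using parts(1)[OF a assms(1)] parts(1)[OF that assms(2)] subsetD[OF supp a]
      by (rule twisted_mult_components)
    then show "(\<Oplus>\<^bsub>sym_alg X\<^esub>b\<in>supp g. cscale (eval_cocycle a b) (parts f a * parts g b))
        = (\<Sum>b\<in>supp g. twisted_mult (parts f a) (parts g b))"
      by (simp add: inner[OF a])
  qed
  also have "\<dots> = twisted_mult (\<Sum>a\<in>supp f. parts f a) (\<Sum>b\<in>supp g. parts g b)"
    by (subst clinear_sum[OF clinear_twisted_left]) (simp add: clinear_sum[OF clinear_twisted_right])
  finally show ?thesis
    using hom_parts_decomposition(3)[OF assms(1)] hom_parts_decomposition(3)[OF assms(2)] by simp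
qed

end

section \<open>The free algebra\<close>
lemma word_mult_eq:
  "word_mult f g = lin_ext (\<lambda>u. lin_ext (\<lambda>v. Poly_Mapping.single (u @ v) 1) g) f"
  by (simp add: word_mult_def lin_ext_def cspace.scale_sum_right)

lemma word_mult_single [simp]:
  "word_mult (Poly_Mapping.single u a) (Poly_Mapping.single v b) = Poly_Mapping.single (u @ v) (a * b)"
  by (simp add: word_mult_eq)

lemma clinear_word_mult_left: "clinear (\<lambda>f. word_mult f g)"
  unfolding word_mult_eq by (rule clinear_lin_ext)

lemma clinear_word_mult_right: "clinear (word_mult f)"
  unfolding word_mult_eq[abs_def] by (rule clinear_lin_ext_coeff) (rule clinear_lin_ext)

lemma word_mult_assoc: "word_mult (word_mult f g) h = word_mult f (word_mult g h)"
  for f g h :: "'a list \<Rightarrow>\<^sub>0 complex"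
proof (rule clinear_eqI[of "\<lambda>f. word_mult (word_mult f g) h" "\<lambda>f. word_mult f (word_mult g h)"])
  fix u :: "'a list"
  let ?u = "Poly_Mapping.single u (1::complex)"
  show "word_mult (word_mult ?u g) h = word_mult ?u (word_mult g h)"
  proof (rule clinear_eqI[of "\<lambda>g. word_mult (word_mult ?u g) h" "\<lambda>g. word_mult ?u (word_mult g h)"])
    fix v :: "'a list"
    let ?v = "Poly_Mapping.single v (1::complex)"
    show "word_mult (word_mult ?u ?v) h = word_mult ?u (word_mult ?v h)"
      by (rule clinear_eqI[of "word_mult (word_mult ?u ?v)" "\<lambda>h. word_mult ?u (word_mult ?v h)"])
        (simp_all add: clinear_word_mult_right clinear_compose[OF clinear_word_mult_right])
  qed (simp_all add: clinear_compose[OF clinear_word_mult_left clinear_word_mult_right]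
      clinear_compose[OF clinear_word_mult_right clinear_word_mult_left])
qed (simp_all add: clinear_word_mult_left clinear_compose[OF clinear_word_mult_left clinear_word_mult_left])

lemma free_alg_simps [simp]:
  "mult (free_alg X) = word_mult" "one (free_alg X) = Poly_Mapping.single [] 1" "zero (free_alg X) = 0"
  "add (free_alg X) = (+)" "module.smult (free_alg X) = cscale"
  by (simp_all add: free_alg_def)

lemma carrier_free_alg: "carrier (free_alg X) = {f. Poly_Mapping.keys f \<subseteq> lists X}"
  by (simp add: free_alg_def)

lemma subspace_free_alg: "cspace.subspace (carrier (free_alg X))"
  unfolding carrier_free_alg by (rule subspace_keys)

lemma word_mult_closed:
  assumes "f \<in> carrier (free_alg X)" "g \<in> carrier (free_alg X)"
  shows "word_mult f g \<in> carrier (free_alg X)"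
proof -
  have "Poly_Mapping.single (u @ v) a \<in> carrier (free_alg X)"
    if "u \<in> Poly_Mapping.keys f" "v \<in> Poly_Mapping.keys g" for u v a
    using that assms by (auto simp: carrier_free_alg)
  then show ?thesis
    unfolding word_mult_def by (intro cspace.subspace_sum subspace_free_alg)
qed

lemma ring_free_alg: "ring (free_alg X)"
proof (rule ringI)
  show "abelian_group (free_alg X)"
  proof (rule abelian_groupI)
    show "\<exists>y\<in>carrier (free_alg X). y \<oplus>\<^bsub>free_alg X\<^esub> x = \<zero>\<^bsub>free_alg X\<^esub>" if "x \<in> carrier (free_alg X)" for x
      using that by (intro bexI[of _ "- x"]) (auto intro: cspace.subspace_neg subspace_free_alg)
  qed (simp_all add: subspace_free_alg cspace.subspace_0 cspace.subspace_add algebra_simps)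
  show "monoid (free_alg X)"
  proof (rule monoidI)
    show "\<one>\<^bsub>free_alg X\<^esub> \<otimes>\<^bsub>free_alg X\<^esub> f = f" for f
      by (simp, rule clinear_eqI[OF clinear_word_mult_right clinear_ident]) simp
    show "f \<otimes>\<^bsub>free_alg X\<^esub> \<one>\<^bsub>free_alg X\<^esub> = f" for f
      by (simp, rule clinear_eqI[OF clinear_word_mult_left clinear_ident]) simp
    show "\<one>\<^bsub>free_alg X\<^esub> \<in> carrier (free_alg X)"
      by (simp add: carrier_free_alg)
  qed (simp_all add: word_mult_closed word_mult_assoc)
qed (simp_all add: clinear_add[OF clinear_word_mult_left] clinear_add[OF clinear_word_mult_right])

lemma minus_free_alg:
  assumes "f \<in> carrier (free_alg X)" "g \<in> carrier (free_alg X)"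
  shows "f \<ominus>\<^bsub>free_alg X\<^esub> g = f - g"
proof -
  interpret ring "free_alg X"
    by (rule ring_free_alg)
  have "\<ominus>\<^bsub>free_alg X\<^esub> g = - g"
    using assms by (intro minus_equality) (auto intro: cspace.subspace_neg subspace_free_alg)
  then show ?thesis
    by (simp add: a_minus_def)
qed

lemma ideal_free_alg_subspace:
  assumes "ideal I (free_alg X)"
  shows "cspace.subspace I"
proof -
  interpret ideal I "free_alg X"
    by (rule assms)
  show ?thesis
  proof (rule cspace.subspaceI)
    show "0 \<in> I"
      using additive_subgroup.zero_closed[OF is_additive_subgroup] by simp
    show "f + g \<in> I" if "f \<in> I" "g \<in> I" for f g
      using additive_subgroup.a_closed[OF is_additive_subgroup that] by simp
    show "cscale c f \<in> I" if "f \<in> I" for c f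
    proof -
      \<comment> \<open>Scalars are multiples of the empty word, so ideals are closed under them.\<close>
      have "word_mult (Poly_Mapping.single [] c) f = cscale c f"
        by (rule clinear_eqI[OF clinear_word_mult_right clinear_cscale[OF clinear_ident]]) simp
      moreover have "Poly_Mapping.single [] c \<in> carrier (free_alg X)"
        by (auto simp: carrier_free_alg split: if_splits)
      ultimately show ?thesis
        using I_l_closed[OF that, of "Poly_Mapping.single [] c"] by simp
    qed
  qed
qed

lemma ideal_free_algI:
  assumes "cspace.subspace K" "K \<subseteq> carrier (free_alg X)"
    and "\<And>f g. f \<in> carrier (free_alg X) \<Longrightarrow> g \<in> K \<Longrightarrow> word_mult f g \<in> K \<and> word_mult g f \<in> K"
  shows "ideal K (free_alg X)"
proof (rule idealI[OF ring_free_alg])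
  interpret ring "free_alg X"
    by (rule ring_free_alg)
  show "subgroup K (add_monoid (free_alg X))"
  proof (rule add.subgroupI)
    show "\<ominus>\<^bsub>free_alg X\<^esub> f \<in> K" if "f \<in> K" for f
    proof -
      have "\<ominus>\<^bsub>free_alg X\<^esub> f = - f"
        using that assms(1,2) by (intro minus_equality) (auto intro: cspace.subspace_neg subspace_free_alg)
      then show ?thesis
        using that assms(1) by (simp add: cspace.subspace_neg)
    qed
  qed (use assms cspace.subspace_0 cspace.subspace_add in auto)
qed (use assms in auto)

context level2_solution
begin

section \<open>The monomial of a word\<close>

text \<open>The cotwisted product of the letters of a word; see \<open>word_hom_mult\<close>.\<close>
primrec word_monom :: "'a list \<Rightarrow> ('a \<Rightarrow>\<^sub>0 nat)" where
  "word_monom [] = 0"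
| "word_monom (x # w) = Poly_Mapping.single x 1 + subst_monom (L x) (word_monom w)"

lemma keys_word_monom: "w \<in> lists X \<Longrightarrow> Poly_Mapping.keys (word_monom w) \<subseteq> X"
  by (induction w) (auto simp: keys_monomial_add keys_subst_monom)

text \<open>The group part of the degree of \<open>word_monom u\<close> acts as the composition of the \<open>L x\<close> over the
  letters \<open>x\<close> of \<open>u\<close>: the variables in the monomial may differ from those of \<open>u\<close> but lie in the same
  orbits.\<close>
lemma word_monom_append:
  assumes "u \<in> lists X" "v \<in> lists X"
  shows "word_monom (u @ v) = word_monom u + subst_monom (act (monom_degree (word_monom u))) (word_monom v)"
  using assms(1)
proof (induction u rule: list.induct)
  case Nil
  have "subst_monom (act \<one>\<^bsub>calH X r\<^esub>) (word_monom v) = word_monom v"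
    using keys_word_monom[OF assms(2)] by (intro subst_monom_id) auto
  then show ?case
    by simp
next
  case (Cons x u)
  let ?m = "word_monom u"
  have x: "x \<in> X" and u: "u \<in> lists X"
    using Cons by auto
  have "act (monom_degree (word_monom (x # u))) y = L x (act (monom_degree ?m) y)" if "y \<in> X" for y
    using x that keys_word_monom[OF u]
    by (simp add: monom_degree_add monom_degree_single[simplified] monom_degree_subst act_mult act_gam)
  then have "subst_monom (act (monom_degree (word_monom (x # u)))) (word_monom v)
      = subst_monom (\<lambda>y. L x (act (monom_degree ?m) y)) (word_monom v)"
    using keys_word_monom[OF assms(2)] by (intro subst_monom_cong) auto
  then show ?case
    using Cons u by (simp add: subst_monom_comp add.assoc)
qed

text \<open>The homomorphism from the free algebra to the cotwisted algebra that is the identity on \<open>X\<close>.\<close>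
definition word_hom :: "('a list \<Rightarrow>\<^sub>0 complex) \<Rightarrow> 'a cpoly" where
  "word_hom = lin_ext (\<lambda>w. Poly_Mapping.single (word_monom w) 1)"

lemma clinear_word_hom: "clinear word_hom"
  unfolding word_hom_def by (rule clinear_lin_ext)

lemma word_hom_single [simp]: "word_hom (Poly_Mapping.single w c) = Poly_Mapping.single (word_monom w) c"
  by (simp add: word_hom_def)

lemma word_hom_in_sym_alg:
  assumes "f \<in> carrier (free_alg X)"
  shows "word_hom f \<in> carrier (sym_alg X)"
  unfolding word_hom_def lin_ext_def
proof (intro cspace.subspace_sum cspace.subspace_scale subspace_carrier_sym_alg)
  fix w
  assume "w \<in> Poly_Mapping.keys f"
  then have "w \<in> lists X"
    using assms by (auto simp: carrier_free_alg)
  then show "Poly_Mapping.single (word_monom w) 1 \<in> carrier (sym_alg X)"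
    using keys_word_monom by (simp add: carrier_sym_alg)
qed

lemma word_hom_mult:
  assumes "f \<in> carrier (free_alg X)" "g \<in> carrier (free_alg X)"
  shows "word_hom (word_mult f g) = twisted_mult (word_hom f) (word_hom g)"
proof (rule clinear_eqI[of "\<lambda>f. word_hom (word_mult f g)" "\<lambda>f. twisted_mult (word_hom f) (word_hom g)"])
  fix u
  assume "u \<in> Poly_Mapping.keys f"
  then have u: "u \<in> lists X"
    using assms by (auto simp: carrier_free_alg)
  let ?u = "Poly_Mapping.single u (1::complex)"
  show "word_hom (word_mult ?u g) = twisted_mult (word_hom ?u) (word_hom g)"
  proof (rule clinear_eqI[of "\<lambda>g. word_hom (word_mult ?u g)" "\<lambda>g. twisted_mult (word_hom ?u) (word_hom g)"])
    fix v
    assume "v \<in> Poly_Mapping.keys g"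
    then have "v \<in> lists X"
      using assms by (auto simp: carrier_free_alg)
    then show "word_hom (word_mult ?u (Poly_Mapping.single v 1))
        = twisted_mult (word_hom ?u) (word_hom (Poly_Mapping.single v 1))"
      using u by (simp add: twisted_mult_def act_poly_def mult_single word_monom_append)
  qed (rule clinear_compose[OF clinear_word_hom clinear_word_mult_right]
      clinear_compose[OF clinear_twisted_right clinear_word_hom])+
qed (rule clinear_compose[OF clinear_word_hom clinear_word_mult_left]
    clinear_compose[OF clinear_twisted_left clinear_word_hom])+

definition relators :: "('a list \<Rightarrow>\<^sub>0 complex) set" where
  "relators = {Poly_Mapping.single [x, y] 1 - Poly_Mapping.single [z, t] 1 | x y z t.
            x \<in> X \<and> y \<in> X \<and> z \<in> X \<and> t \<in> X \<and> r (x, y) = (z, t)}"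

abbreviation rel_ideal :: "('a list \<Rightarrow>\<^sub>0 complex) set" where
  "rel_ideal \<equiv> genideal (free_alg X) relators"

sublocale free: ring "free_alg X"
  by (rule ring_free_alg)

lemma single_in_free_alg: "w \<in> lists X \<Longrightarrow> Poly_Mapping.single w c \<in> carrier (free_alg X)"
  by (auto simp: carrier_free_alg split: if_splits)

lemma relators_subset: "relators \<subseteq> carrier (free_alg X)"
  by (auto simp: relators_def intro!: cspace.subspace_diff[OF subspace_free_alg] single_in_free_alg)

lemma ideal_rel_ideal: "ideal rel_ideal (free_alg X)"
  by (rule free.genideal_ideal[OF relators_subset])

lemma subspace_rel_ideal: "cspace.subspace rel_ideal"
  by (rule ideal_free_alg_subspace[OF ideal_rel_ideal])

lemma relator_in:
  assumes "x \<in> X" "y \<in> X"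
  shows "Poly_Mapping.single [x, y] 1 - Poly_Mapping.single [L x y, R y x] 1 \<in> rel_ideal"
proof (rule subsetD[OF free.genideal_self[OF relators_subset]])
  show "Poly_Mapping.single [x, y] 1 - Poly_Mapping.single [L x y, R y x] 1 \<in> relators"
    unfolding relators_def using assms
    by (intro CollectI exI[of _ x] exI[of _ y] exI[of _ "L x y"] exI[of _ "R y x"]) (simp add: r_eq)
qed

text \<open>The kernel is an ideal, and it contains the relations because both \<open>[x, y]\<close> and
  \<open>[L x y, R y x]\<close> have the monomial \<open>x \<cdot> L x y\<close>.\<close>
lemma word_hom_rel_ideal:
  assumes "f \<in> rel_ideal"
  shows "word_hom f = 0"
proof -
  let ?K = "{f \<in> carrier (free_alg X). word_hom f = 0}"
  have "ideal ?K (free_alg X)"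
  proof (rule ideal_free_algI)
    show "cspace.subspace ?K"
      by (rule cspace.subspaceI)
        (auto simp: clinear_0[OF clinear_word_hom] clinear_add[OF clinear_word_hom] clinear_scale[OF clinear_word_hom]
          intro: cspace.subspace_0 cspace.subspace_add cspace.subspace_scale subspace_free_alg)
    show "word_mult f g \<in> ?K \<and> word_mult g f \<in> ?K" if "f \<in> carrier (free_alg X)" "g \<in> ?K" for f g
      using that
      by (simp add: word_mult_closed word_hom_mult clinear_0[OF clinear_twisted_left] clinear_0[OF clinear_twisted_right])
  qed auto
  moreover have "relators \<subseteq> ?K"
  proof
    fix f
    assume f: "f \<in> relators"
    then obtain x y where xy: "x \<in> X" "y \<in> X"
      "f = Poly_Mapping.single [x, y] 1 - Poly_Mapping.single [L x y, R y x] 1"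
      by (auto simp: relators_def r_eq)
    then have "word_hom f = 0"
      by (simp add: clinear_diff[OF clinear_word_hom] L_involutive add.commute)
    then show "f \<in> ?K"
      using f relators_subset by auto
  qed
  ultimately have "rel_ideal \<subseteq> ?K"
    by (rule free.genideal_minimal)
  then show ?thesis
    using assms by auto
qed

definition word_eqv :: "'a list \<Rightarrow> 'a list \<Rightarrow> bool" where
  "word_eqv u v \<longleftrightarrow> u \<in> lists X \<and> v \<in> lists X \<and>
     Poly_Mapping.single u 1 - Poly_Mapping.single v 1 \<in> rel_ideal"

lemma word_eqv_refl: "u \<in> lists X \<Longrightarrow> word_eqv u u"
  by (simp add: word_eqv_def cspace.subspace_0[OF subspace_rel_ideal])

lemma word_eqv_trans [trans]: "word_eqv u v \<Longrightarrow> word_eqv v w \<Longrightarrow> word_eqv u w"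
  using cspace.subspace_add[OF subspace_rel_ideal,
      of "Poly_Mapping.single u 1 - Poly_Mapping.single v 1" "Poly_Mapping.single v 1 - Poly_Mapping.single w 1"]
  by (auto simp: word_eqv_def)

lemma word_eqv_append:
  assumes "word_eqv u v" "w \<in> lists X"
  shows word_eqv_append_left: "word_eqv (w @ u) (w @ v)"
    and word_eqv_append_right: "word_eqv (u @ w) (v @ w)"
proof -
  let ?d = "Poly_Mapping.single u 1 - Poly_Mapping.single v (1::complex)"
  have d: "?d \<in> rel_ideal" and w: "Poly_Mapping.single w 1 \<in> carrier (free_alg X)"
    using assms by (auto simp: word_eqv_def single_in_free_alg)
  have "word_mult (Poly_Mapping.single w 1) ?d \<in> rel_ideal" "word_mult ?d (Poly_Mapping.single w 1) \<in> rel_ideal"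
    using ideal.I_l_closed[OF ideal_rel_ideal d w] ideal.I_r_closed[OF ideal_rel_ideal d w] by simp_all
  then show "word_eqv (w @ u) (w @ v)" "word_eqv (u @ w) (v @ w)"
    using assms by (simp_all add: word_eqv_def clinear_diff[OF clinear_word_mult_left]
        clinear_diff[OF clinear_word_mult_right])
qed

lemma word_eqv_monom:
  assumes "word_eqv u v"
  shows "word_monom u = word_monom v"
proof -
  have "Poly_Mapping.single (word_monom u) (1::complex) = Poly_Mapping.single (word_monom v) 1"
    using assms word_hom_rel_ideal[of "Poly_Mapping.single u 1 - Poly_Mapping.single v 1"]
    by (simp add: word_eqv_def clinear_diff[OF clinear_word_hom])
  then have "Poly_Mapping.keys (Poly_Mapping.single (word_monom u) (1::complex)) = Poly_Mapping.keys (Poly_Mapping.single (word_monom v) (1::complex))"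
    by simp
  then show ?thesis
    by simp
qed

text \<open>If \<open>z\<close> does not come from the first letter \<open>x\<close>, then \<open>z = L x b\<close> for a variable \<open>b\<close> of the rest, which
  by induction can be made the second letter. The relation then turns \<open>x b\<close> into \<open>z (R b x)\<close>.\<close>
lemma letter_to_front:
  assumes "u \<in> lists X" "z \<in> Poly_Mapping.keys (word_monom u)"
  shows "\<exists>u'. u' \<in> lists X \<and> word_eqv u (z # u')"
  using assms
proof (induction u arbitrary: z rule: list.induct)
  case (Cons x w)
  have x: "x \<in> X" and w: "w \<in> lists X"
    using Cons.prems by auto
  show ?case
  proof (cases "z = x")
    case True
    then show ?thesis
      using w word_eqv_refl[OF Cons.prems(1)] by blast
  next
    case False
    then obtain b where b: "b \<in> Poly_Mapping.keys (word_monom w)" "z = L x b"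
      using Cons.prems(2) by (auto simp: keys_monomial_add keys_subst_monom)
    obtain w' where w': "w' \<in> lists X" "word_eqv w (b # w')"
      using Cons.IH[OF w b(1)] by auto
    have bX: "b \<in> X"
      using b keys_word_monom[OF w] by auto
    have "word_eqv (x # w) (x # b # w')"
      using word_eqv_append_left[OF w'(2), of "[x]"] x by simp
    also have "word_eqv [x, b] [L x b, R b x]"
      using x bX by (simp add: word_eqv_def relator_in)
    then have "word_eqv (x # b # w') (L x b # R b x # w')"
      using word_eqv_append_right[OF _ w'(1)] by fastforce
    finally have "word_eqv (x # w) (z # R b x # w')"
      by (simp add: b(2))
    then show ?thesis
      using w' x bX by (intro exI[of _ "R b x # w'"]) simp
  qed
qed simp

lemma subst_L_injective:
  assumes "z \<in> X" "Poly_Mapping.keys m \<subseteq> X" "Poly_Mapping.keys n \<subseteq> X"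
    and "subst_monom (L z) m = subst_monom (L z) n"
  shows "m = n"
proof -
  have "subst_monom (\<lambda>x. inv_into X (L z) (L z x)) k = k" if "Poly_Mapping.keys k \<subseteq> X" for k
    using that L_bij[OF assms(1)] by (intro subst_monom_id) (auto simp: bij_betw_def)
  then show ?thesis
    using assms(2-) by (metis subst_monom_comp)
qed

text \<open>Move the first letter of \<open>v\<close> to the front of \<open>u\<close> and cancel it. Words that agree modulo the
  relations have the same monomial, so the remaining words also have equal monomials.\<close>
lemma word_eqv_if_same_monom:
  assumes "u \<in> lists X" "v \<in> lists X" "word_monom u = word_monom v"
  shows "word_eqv u v"
  using assms
proof (induction v arbitrary: u rule: list.induct)
  case Nil
  have "u = []"
  proof (cases u)
    case (Cons x w)
    then have "x \<in> Poly_Mapping.keys (word_monom u)"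
      by (simp add: keys_monomial_add)
    then show ?thesis
      by (simp add: Nil.prems(3))
  qed
  then show ?case
    by (simp add: word_eqv_refl)
next
  case (Cons z v)
  have z: "z \<in> X" and v: "v \<in> lists X"
    using Cons.prems by auto
  have "z \<in> Poly_Mapping.keys (word_monom u)"
    by (simp add: Cons.prems keys_monomial_add)
  then obtain u' where u': "u' \<in> lists X" "word_eqv u (z # u')"
    using letter_to_front[OF Cons.prems(1)] by blast
  have "subst_monom (L z) (word_monom u') = subst_monom (L z) (word_monom v)"
    using word_eqv_monom[OF u'(2)] Cons.prems(3) by simp
  then have "word_monom u' = word_monom v"
    by (rule subst_L_injective[OF z keys_word_monom[OF u'(1)] keys_word_monom[OF v]])
  then have "word_eqv u' v"
    by (rule Cons.IH[OF u'(1) v])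
  then have "word_eqv (z # u') (z # v)"
    using word_eqv_append_left[of u' v "[z]"] z by simp
  then show ?case
    by (rule word_eqv_trans[OF u'(2)])
qed

text \<open>Build the word from left to right: appending a letter \<open>y\<close> multiplies the monomial \<open>m\<close> by the translate
  of \<open>y\<close> under the degree of \<open>m\<close>, and translations are invertible.\<close>
lemma word_monom_surj:
  assumes "Poly_Mapping.keys m \<subseteq> X"
  shows "\<exists>w\<in>lists X. word_monom w = m"
  using assms
proof (induction m rule: monomial_induct[consumes 1])
  case zero
  then show ?case
    by (intro bexI[of _ "[]"]) auto
next
  case (add x m)
  then obtain w where w: "w \<in> lists X" "word_monom w = m"
    by auto
  let ?h = "inv\<^bsub>calH X r\<^esub> monom_degree m"
  \<comment> \<open>The letter whose translate by the degree of \<open>m\<close> is \<open>x\<close>.\<close>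
  let ?y = "act ?h x"
  have "act (monom_degree m) ?y = x"
    using add(1) act_mult[of "monom_degree m" ?h x] by simp
  moreover have "?y \<in> X"
    using add(1) by simp
  ultimately have "word_monom (w @ [?y]) = Poly_Mapping.single x 1 + m"
    using w by (subst word_monom_append) (simp_all add: add.commute)
  then show ?case
    using w \<open>?y \<in> X\<close> by (intro bexI[of _ "w @ [?y]"]) simp_all
qed

section \<open>The isomorphism\<close>
definition section_word :: "('a \<Rightarrow>\<^sub>0 nat) \<Rightarrow> 'a list" where
  "section_word m = (SOME w. w \<in> lists X \<and> word_monom w = m)"

lemma section_word:
  assumes "Poly_Mapping.keys m \<subseteq> X"
  shows "section_word m \<in> lists X" "word_monom (section_word m) = m"
  using someI_ex[of "\<lambda>w. w \<in> lists X \<and> word_monom w = m"] word_monom_surj[OF assms]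
  unfolding section_word_def by blast+

definition lift_poly :: "'a cpoly \<Rightarrow> ('a list \<Rightarrow>\<^sub>0 complex)" where
  "lift_poly = lin_ext (\<lambda>m. Poly_Mapping.single (section_word m) 1)"

lemma clinear_lift: "clinear lift_poly"
  unfolding lift_poly_def by (rule clinear_lin_ext)

lemma lift_in_free_alg:
  assumes "f \<in> carrier (sym_alg X)"
  shows "lift_poly f \<in> carrier (free_alg X)"
  unfolding lift_poly_def lin_ext_def
  using assms section_word
  by (intro cspace.subspace_sum cspace.subspace_scale subspace_free_alg single_in_free_alg)
    (auto simp: carrier_sym_alg)

lemma word_hom_lift:
  assumes "f \<in> carrier (sym_alg X)"
  shows "word_hom (lift_poly f) = f"
  by (rule clinear_eqI[OF clinear_compose[OF clinear_word_hom clinear_lift] clinear_ident])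
    (use assms section_word in \<open>auto simp: lift_poly_def carrier_sym_alg\<close>)

text \<open>Modulo the relations, every word equals the chosen word with the same monomial. So \<open>f\<close> is
  congruent to the lift of its image, which vanishes if the image does.\<close>
lemma word_hom_eq_0_iff:
  assumes "f \<in> carrier (free_alg X)"
  shows "word_hom f = 0 \<longleftrightarrow> f \<in> rel_ideal"
proof
  assume 0: "word_hom f = 0"
  let ?s = "\<lambda>w. section_word (word_monom w)"
  have "lift_poly (word_hom f) = lin_ext (\<lambda>w. Poly_Mapping.single (?s w) 1) f"
    by (rule clinear_eqI[OF clinear_compose[OF clinear_lift clinear_word_hom] clinear_lin_ext])
      (simp add: lift_poly_def)
  then have "f = f - lin_ext (\<lambda>w. Poly_Mapping.single (?s w) 1) f"
    by (simp add: 0 clinear_0[OF clinear_lift])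
  also have "\<dots> = (\<Sum>w\<in>Poly_Mapping.keys f. cscale (Poly_Mapping.lookup f w)
      (Poly_Mapping.single w 1 - Poly_Mapping.single (?s w) 1))"
    by (simp add: lin_ext_def cspace.scale_right_diff_distrib sum_subtractf sum_singles)
  also have "\<dots> \<in> rel_ideal"
  proof (intro cspace.subspace_sum cspace.subspace_scale subspace_rel_ideal)
    fix w
    assume "w \<in> Poly_Mapping.keys f"
    then have w: "w \<in> lists X"
      using assms by (auto simp: carrier_free_alg)
    have "word_eqv w (?s w)"
      using section_word[OF keys_word_monom[OF w]] by (intro word_eqv_if_same_monom w) auto
    then show "Poly_Mapping.single w 1 - Poly_Mapping.single (?s w) 1 \<in> rel_ideal"
      by (simp add: word_eqv_def)
  qed
  finally show "f \<in> rel_ideal" .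
qed (rule word_hom_rel_ideal)

lemma cotwisted_simps [simp]:
  "carrier (cotwisted_sym_alg X r) = carrier (sym_alg X)" "one (cotwisted_sym_alg X r) = 1"
  "add (cotwisted_sym_alg X r) = (+)" "module.smult (cotwisted_sym_alg X r) = cscale"
  by (simp_all add: cotwisted_sym_alg_def cotwist_def)

abbreviation coset :: "('a list \<Rightarrow>\<^sub>0 complex) \<Rightarrow> ('a list \<Rightarrow>\<^sub>0 complex) set" where
  "coset f \<equiv> rel_ideal +>\<^bsub>free_alg X\<^esub> f"

lemma coset_eq_iff:
  assumes "f \<in> carrier (free_alg X)" "g \<in> carrier (free_alg X)"
  shows "coset f = coset g \<longleftrightarrow> word_hom f = word_hom g"
  using free.quotient_eq_iff_same_a_r_cos[OF ideal_rel_ideal assms] assms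
    word_hom_eq_0_iff[of "f - g"] clinear_diff[OF clinear_word_hom, of f g]
  by (simp add: minus_free_alg cspace.subspace_diff[OF subspace_free_alg])

lemma coset_member:
  assumes "f \<in> carrier (free_alg X)" "g \<in> coset f"
  shows "g \<in> carrier (free_alg X) \<and> word_hom g = word_hom f"
proof -
  obtain i where "i \<in> rel_ideal" "g = i + f"
    using assms(2) by (auto simp: a_r_coset_def')
  then show ?thesis
    using assms(1) ideal.Icarr[OF ideal_rel_ideal, of i] word_hom_rel_ideal[of i]
    by (simp add: clinear_add[OF clinear_word_hom] cspace.subspace_add[OF subspace_free_alg])
qed

text \<open>A coset is the set of preimages of one element of the cotwisted algebra; the map sends this
  element to the coset. Every identity between cosets can thus be checked after \<^const>\<open>word_hom\<close>.\<close>
lemma coset_lift_iso: "(\<lambda>f. coset (lift_poly f)) \<in> alg_iso (cotwisted_sym_alg X r) (quot_alg (free_alg X) rel_ideal)"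
proof -
  interpret ideal rel_ideal "free_alg X"
    by (rule ideal_rel_ideal)
  let ?A = "cotwisted_sym_alg X r" and ?Q = "quot_alg (free_alg X) rel_ideal" and ?\<psi> = "\<lambda>f. coset (lift_poly f)"
  have twisted_closed: "twisted_mult f g \<in> carrier (sym_alg X)"
    if "f \<in> carrier (sym_alg X)" "g \<in> carrier (sym_alg X)" for f g
    using word_hom_in_sym_alg[OF word_mult_closed[OF lift_in_free_alg lift_in_free_alg], OF that] that
    by (simp add: word_hom_mult lift_in_free_alg word_hom_lift)
  have "?\<psi> \<in> ring_hom ?A ?Q"
  proof (rule ring_hom_memI)
    show "?\<psi> f \<in> carrier ?Q" if "f \<in> carrier ?A" for f
      using that by (simp add: quot_alg_def FactRing_def free.a_rcosetsI[OF a_subset] lift_in_free_alg)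
    show "?\<psi> (f \<otimes>\<^bsub>?A\<^esub> g) = ?\<psi> f \<otimes>\<^bsub>?Q\<^esub> ?\<psi> g" if "f \<in> carrier ?A" "g \<in> carrier ?A" for f g
    proof -
      have fg: "lift_poly f \<in> carrier (free_alg X)" "lift_poly g \<in> carrier (free_alg X)"
        using that by (simp_all add: lift_in_free_alg)
      have "?\<psi> f \<otimes>\<^bsub>?Q\<^esub> ?\<psi> g = coset (word_mult (lift_poly f) (lift_poly g))"
        using rcoset_mult_add[OF fg] by (simp add: quot_alg_def FactRing_def)
      also have "\<dots> = ?\<psi> (twisted_mult f g)"
        using that fg by (simp add: coset_eq_iff word_mult_closed lift_in_free_alg twisted_closed word_hom_mult word_hom_lift)
      finally show ?thesis
        using that by (simp add: mult_cotwisted)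
    qed
    show "?\<psi> (f \<oplus>\<^bsub>?A\<^esub> g) = ?\<psi> f \<oplus>\<^bsub>?Q\<^esub> ?\<psi> g" if "f \<in> carrier ?A" "g \<in> carrier ?A" for f g
      using that a_rcos_sum[of "lift_poly f" "lift_poly g"]
      by (simp add: quot_alg_def FactRing_def lift_in_free_alg clinear_add[OF clinear_lift])
    have "1 \<in> carrier (sym_alg X)"
      by (simp add: carrier_sym_alg)
    then show "?\<psi> \<one>\<^bsub>?A\<^esub> = \<one>\<^bsub>?Q\<^esub>"
      by (simp add: quot_alg_def FactRing_def coset_eq_iff lift_in_free_alg single_in_free_alg word_hom_lift)
  qed
  moreover have "bij_betw ?\<psi> (carrier ?A) (carrier ?Q)"
  proof (rule bij_betwI')
    show "?\<psi> f = ?\<psi> g \<longleftrightarrow> f = g" if "f \<in> carrier ?A" "g \<in> carrier ?A" for f g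
      using that by (simp add: coset_eq_iff lift_in_free_alg word_hom_lift)
    show "?\<psi> f \<in> carrier ?Q" if "f \<in> carrier ?A" for f
      using that by (simp add: quot_alg_def FactRing_def free.a_rcosetsI[OF a_subset] lift_in_free_alg)
    fix S
    assume "S \<in> carrier ?Q"
    then obtain w where w: "w \<in> carrier (free_alg X)" "S = coset w"
      by (auto simp: quot_alg_def FactRing_def A_RCOSETS_def')
    then have "S = ?\<psi> (word_hom w)"
      by (simp add: coset_eq_iff lift_in_free_alg word_hom_in_sym_alg word_hom_lift)
    then show "\<exists>f\<in>carrier ?A. S = ?\<psi> f"
      using w word_hom_in_sym_alg by auto
  qed
  moreover have "?\<psi> (c \<odot>\<^bsub>?A\<^esub> f) = c \<odot>\<^bsub>?Q\<^esub> ?\<psi> f" if "f \<in> carrier ?A" for c f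
  proof -
    have f: "lift_poly f \<in> carrier (free_alg X)"
      using that by (simp add: lift_in_free_alg)
    have "coset (cscale c g) = coset (cscale c (lift_poly f))" if "g \<in> ?\<psi> f" for g
      using coset_member[OF f that] f
      by (simp add: coset_eq_iff cspace.subspace_scale[OF subspace_free_alg] clinear_scale[OF clinear_word_hom])
    then have "c \<odot>\<^bsub>?Q\<^esub> ?\<psi> f = (\<Union>g\<in>?\<psi> f. coset (cscale c (lift_poly f)))"
      by (simp add: quot_alg_def)
    also have "\<dots> = coset (cscale c (lift_poly f))"
      using a_rcos_self[OF f] by auto
    finally show ?thesis
      by (simp add: clinear_scale[OF clinear_lift])
  qed
  ultimately show ?thesis
    by (simp add: alg_iso_def ring_iso_def)
qed

text \<open>On a word \<open>[x, y]\<close>, \<open>id - R\<close> gives the relator of \<open>(x, y)\<close>, so the two sets of generators have the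
  same linear span.\<close>
lemma R_relators_generate:
  "genideal (free_alg X) ((\<lambda>f. f - lin_R r f) ` tensor_square X) = rel_ideal"
proof -
  let ?S = "(\<lambda>f. f - lin_R r f) ` tensor_square X"
  have lin: "clinear (lin_R r)"
    unfolding lin_R_def by (rule clinear_lin_ext)
  have S: "?S \<subseteq> rel_ideal"
  proof clarify
    fix f
    assume f: "f \<in> tensor_square X"
    let ?w = "\<lambda>w. [L (w ! 0) (w ! 1), R (w ! 1) (w ! 0)]"
    have "f - lin_R r f = (\<Sum>w\<in>Poly_Mapping.keys f. cscale (Poly_Mapping.lookup f w)
        (Poly_Mapping.single w 1 - Poly_Mapping.single (?w w) 1))"
      by (simp add: lin_R_def lin_ext_def cspace.scale_right_diff_distrib sum_subtractf sum_singles lact_def ract_def)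
    also have "\<dots> \<in> rel_ideal"
    proof (intro cspace.subspace_sum cspace.subspace_scale subspace_rel_ideal)
      fix w
      assume "w \<in> Poly_Mapping.keys f"
      then have "length w = 2" "w \<in> lists X"
        using f by (auto simp: tensor_square_def carrier_free_alg)
      then obtain x y where "w = [x, y]" "x \<in> X" "y \<in> X"
        by (auto simp: length_Suc_conv numeral_2_eq_2)
      then show "Poly_Mapping.single w 1 - Poly_Mapping.single (?w w) 1 \<in> rel_ideal"
        using relator_in by simp
    qed
    finally show "f - lin_R r f \<in> rel_ideal" .
  qed
  then have Sc: "?S \<subseteq> carrier (free_alg X)"
    using ideal.Icarr[OF ideal_rel_ideal] by blast
  have "relators \<subseteq> ?S"
  proof
    fix f
    assume "f \<in> relators"
    then obtain x y where xy: "x \<in> X" "y \<in> X"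
      "f = Poly_Mapping.single [x, y] 1 - Poly_Mapping.single [L x y, R y x] 1"
      by (auto simp: relators_def r_eq)
    then have "f = Poly_Mapping.single [x, y] 1 - lin_R r (Poly_Mapping.single [x, y] 1)"
      by (simp add: lin_R_def lact_def ract_def)
    moreover have "Poly_Mapping.single [x, y] 1 \<in> tensor_square X"
      using xy by (simp add: tensor_square_def single_in_free_alg)
    ultimately show "f \<in> ?S"
      by blast
  qed
  then have "relators \<subseteq> genideal (free_alg X) ?S"
    using free.genideal_self[OF Sc] by blast
  then show ?thesis
    using free.genideal_minimal[OF free.genideal_ideal[OF Sc]] free.genideal_minimal[OF ideal_rel_ideal S]
    by blast
qed

end

theorem proposition6p4:
  fixes X :: "'a set" and r :: "'a \<times> 'a \<Rightarrow> 'a \<times> 'a"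
  assumes "finite X"
    and "symmetric_set X r"
    and "nondegenerate X r"
    and "square_free X r"
    and "mpl_level_2 X r"
  shows "alg_isomorphic (cotwisted_sym_alg X r) (R_sym_alg X r) \<and>
         alg_isomorphic (cotwisted_sym_alg X r) (YB_alg X r)"
proof -
  interpret level2_solution X r
    by (rule level2_solution.intro) (fact assms)+
  have "YB_alg X r = quot_alg (free_alg X) rel_ideal"
    by (simp add: YB_alg_def relators_def)
  moreover have "R_sym_alg X r = quot_alg (free_alg X) rel_ideal"
    by (simp add: R_sym_alg_def R_relators_generate)
  ultimately show ?thesis
    using coset_lift_iso by (auto simp: alg_isomorphic_def)
qed

end
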